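(* Let $r,t>1$ be integers. Up to isomorphism there is a unique tree with passport $[r,t,1^{r+t-2};2^{r+t-1}]$, and its monodromy group $G$ satisfies $$G\cong\begin{cases}A_{2r-1}\times\mathbb{Z}_2 & \text{if } r=t \text{ and } r \text{ is odd},\\ S_{2r-1}\times\mathbb{Z}_2 & \text{if } r=t \text{ and } r\text{ is even},\\ A_{r+t-1}\wr\mathbb{Z}_2 & \text{if } r\ne t \text{ and both } r,t \text{ are odd},\\ R_2 & \text{if } r\neq t\text{ and both } r,t\text{ are even},\\ S_{r+t-1}\wr\mathbb{Z}_2 & \text{if } r\ne t \text{ otherwise},\end{cases}$$ where $R_2$ denotes the index $2$ subgroup of $S_{r+t-1}\wr\mathbb{Z}_2$ containing $A_{r+t-1}\wr\mathbb{Z}_2$ and an element $(\zeta_1,\zeta_2,0)$ with $\operatorname{sgn}(\zeta_1)=\operatorname{sgn}(\zeta_2)=-1$.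
   Context: A dessin is a connected bicolored (black/white, every edge joining a black and a white vertex) graph with a cyclic (counterclockwise) ordering of the edges around each vertex; here all dessins are finite trees, and an isomorphism is a graph isomorphism preserving colors and cyclic orderings. The passport of a dessin is the pair of lists $[b_1,\dots,b_k;w_1,\dots,w_\ell]$ of degrees of the black vertices and of the white vertices (multisets); within a list, $a^m$ denotes $m$ vertices of degree $a$. Label the edges of a dessin $1,\dots,n$. Let $\sigma_0\in S_n$ (resp. $\sigma_1\in S_n$) be the product of the cycles given by the cyclic orders of the edges around the black (resp. white) vertices. The monodromy group of the dessin is $\langle\sigma_0,\sigma_1\rangle\le S_n$ (independent of the labeling up to conjugacy). For a group $H$, the wreath product $H\wr\mathbb{Z}_2$ is the semidirect product $H^2\rtimes\mathbb{Z}_2$ with $\mathbb{Z}_2=\{0,1\}$ acting by interchanging the two factors; its elements are written $(h_1,h_2,g)$ with $h_1,h_2\in H$, $g\in\mathbb{Z}_2$. $S_m$ and $A_m$ are the symmetric and alternating groups. Equivalently, $R_2$ is the set of all $(\tau_1,\tau_2,g)\in S_{r+t-1}\wr\mathbb{Z}_2$ such that $\tau_1\tau_2$ is an even permutation. *)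

theory Defs
  imports "HOL-Algebra.Sym_Groups" "HOL-Algebra.Elementary_Groups" "HOL-Combinatorics.Orbits"
    "HOL-Library.Multiset"
begin

text \<open>
  Edges are abstract objects with a black and a white end, so that parallel edges are possible in
  a dessin; trees exclude them. The edge following \<open>e\<close> counterclockwise around a vertex \<open>v\<close> is
  \<open>rot D v e\<close>; only the values for edges \<open>e\<close> incident with \<open>v\<close> are relevant.
\<close>

record ('v, 'e) dessin =
  black :: "'v set"
  white :: "'v set"
  edges :: "'e set"
  bend :: "'e \<Rightarrow> 'v"
  wend :: "'e \<Rightarrow> 'v"
  rot :: "'v \<Rightarrow> 'e \<Rightarrow> 'e"

definition vertices :: "('v, 'e) dessin \<Rightarrow> 'v set" where
  "vertices D = black D \<union> white D"

definition ends :: "('v, 'e) dessin \<Rightarrow> 'e \<Rightarrow> 'v set" where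
  "ends D e = {bend D e, wend D e}"

definition star :: "('v, 'e) dessin \<Rightarrow> 'v \<Rightarrow> 'e set" where
  "star D v = {e \<in> edges D. v \<in> ends D e}"

definition degree :: "('v, 'e) dessin \<Rightarrow> 'v \<Rightarrow> nat" where
  "degree D v = card (star D v)"

text \<open>A walk is given by the list of its vertices and the list of its edges.\<close>

definition walk :: "('v, 'e) dessin \<Rightarrow> 'v list \<Rightarrow> 'e list \<Rightarrow> bool" where
  "walk D vs es \<longleftrightarrow> length vs = Suc (length es) \<and> set vs \<subseteq> vertices D \<and> set es \<subseteq> edges D \<and>
     (\<forall>i < length es. ends D (es ! i) = {vs ! i, vs ! Suc i})"

definition connected_dessin :: "('v, 'e) dessin \<Rightarrow> bool" where
  "connected_dessin D \<longleftrightarrow> vertices D \<noteq> {} \<and>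
     (\<forall>u \<in> vertices D. \<forall>v \<in> vertices D. \<exists>vs es. walk D vs es \<and> hd vs = u \<and> last vs = v)"

text \<open>Two parallel edges form a cycle of length two, traversing one edge back and forth does not.\<close>

definition cycle_in :: "('v, 'e) dessin \<Rightarrow> 'v list \<Rightarrow> 'e list \<Rightarrow> bool" where
  "cycle_in D vs es \<longleftrightarrow> walk D vs es \<and> es \<noteq> [] \<and> hd vs = last vs \<and> distinct (tl vs) \<and> distinct es"

definition is_dessin :: "('v, 'e) dessin \<Rightarrow> bool" where
  "is_dessin D \<longleftrightarrow>
     finite (vertices D) \<and> finite (edges D) \<and> black D \<inter> white D = {} \<and>
     (\<forall>e \<in> edges D. bend D e \<in> black D \<and> wend D e \<in> white D) \<and>
     connected_dessin D \<and>
     (\<forall>v \<in> vertices D. star D v \<noteq> {} \<longrightarrow> cyclic_on (rot D v) (star D v))"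

definition is_tree :: "('v, 'e) dessin \<Rightarrow> bool" where
  "is_tree D \<longleftrightarrow> is_dessin D \<and> (\<nexists>vs es. cycle_in D vs es)"

definition dessin_iso :: "('v, 'e) dessin \<Rightarrow> ('w, 'f) dessin \<Rightarrow> bool" where
  "dessin_iso D D' \<longleftrightarrow> (\<exists>\<phi> \<psi>.
     bij_betw \<phi> (vertices D) (vertices D') \<and> \<phi> ` black D = black D' \<and> \<phi> ` white D = white D' \<and>
     bij_betw \<psi> (edges D) (edges D') \<and>
     (\<forall>e \<in> edges D. bend D' (\<psi> e) = \<phi> (bend D e) \<and> wend D' (\<psi> e) = \<phi> (wend D e)) \<and>
     (\<forall>v \<in> vertices D. \<forall>e \<in> star D v. rot D' (\<phi> v) (\<psi> e) = \<psi> (rot D v e)))"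

definition passport :: "('v, 'e) dessin \<Rightarrow> nat multiset \<times> nat multiset" where
  "passport D = (image_mset (degree D) (mset_set (black D)),
                 image_mset (degree D) (mset_set (white D)))"

definition labelling :: "('v, 'e) dessin \<Rightarrow> ('e \<Rightarrow> nat) \<Rightarrow> bool" where
  "labelling D l \<longleftrightarrow> bij_betw l (edges D) {1..card (edges D)}"

definition sigma0 :: "('v, 'e) dessin \<Rightarrow> ('e \<Rightarrow> nat) \<Rightarrow> nat \<Rightarrow> nat" where
  "sigma0 D l i = (if i \<in> {1..card (edges D)}
     then let e = inv_into (edges D) l i in l (rot D (bend D e) e) else i)"

definition sigma1 :: "('v, 'e) dessin \<Rightarrow> ('e \<Rightarrow> nat) \<Rightarrow> nat \<Rightarrow> nat" where
  "sigma1 D l i = (if i \<in> {1..card (edges D)}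
     then let e = inv_into (edges D) l i in l (rot D (wend D e) e) else i)"

definition monodromy_group :: "('v, 'e) dessin \<Rightarrow> ('e \<Rightarrow> nat) \<Rightarrow> (nat \<Rightarrow> nat) monoid" where
  "monodromy_group D l =
     subgroup_generated (sym_group (card (edges D))) {sigma0 D l, sigma1 D l}"

text \<open>
  \<open>subgroup_generated\<close> intersects its generating set with the carrier; by \<open>sigma_permutes\<close> below
  this discards nothing for a dessin with labelled edges.
\<close>

lemma rot_bij_betw:
  assumes D: "is_dessin D"
    and v: "\<And>e. e \<in> edges D \<Longrightarrow> v e \<in> vertices D"
    and star: "\<And>e. e \<in> edges D \<Longrightarrow> star D (v e) = {e' \<in> edges D. v e' = v e}"
  shows "bij_betw (\<lambda>e. rot D (v e) e) (edges D) (edges D)"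
proof -
  let ?f = "\<lambda>e. rot D (v e) e"
  have fin: "finite (edges D)" using D by (simp add: is_dessin_def)
  have cyc: "cyclic_on (rot D (v e)) (star D (v e))" if e: "e \<in> edges D" for e
  proof -
    have "e \<in> star D (v e)" using e star by simp
    then show ?thesis using D v[OF e] unfolding is_dessin_def by blast
  qed
  have "edges D \<subseteq> ?f ` edges D"
  proof
    fix e assume e: "e \<in> edges D"
    have es: "e \<in> star D (v e)" using e star by simp
    have "e \<in> orbit (rot D (v e)) e"
      using cyc[OF e] es unfolding cyclic_on_alldef by blast
    then obtain e' where e': "e' \<in> star D (v e)" "e = rot D (v e) e'"
    proof (cases rule: orbit.cases)
      case base
      then show ?thesis using es that by simp
    next
      case (step y)
      have "orbit (rot D (v e)) e = star D (v e)"
        using cyc[OF e] es unfolding cyclic_on_alldef by blast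
      then show ?thesis using step that by simp
    qed
    then have "e' \<in> edges D" "v e' = v e" using star[OF e] by auto
    then have "?f e' = e" using e'(2) by simp
    with \<open>e' \<in> edges D\<close> show "e \<in> ?f ` edges D" by (intro rev_image_eqI[of e']) simp_all
  qed
  moreover have "?f ` edges D \<subseteq> edges D"
  proof (rule image_subsetI)
    fix e assume e: "e \<in> edges D"
    have "e \<in> star D (v e)" using e star by simp
    then have "rot D (v e) e \<in> star D (v e)" by (rule cyclic_on_inI[OF cyc[OF e]])
    then show "rot D (v e) e \<in> edges D" by (simp add: star_def)
  qed
  ultimately have im: "?f ` edges D = edges D" by blast
  have "inj_on ?f (edges D)"
    by (rule eq_card_imp_inj_on[OF fin]) (simp add: im)
  then show ?thesis using im by (simp add: bij_betw_def)
qed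

lemma labelled_permutes:
  assumes l: "labelling D l" and f: "bij_betw f (edges D) (edges D)"
  shows "(\<lambda>i. if i \<in> {1..card (edges D)} then l (f (inv_into (edges D) l i)) else i)
    permutes {1..card (edges D)}"
proof -
  have "bij_betw (l \<circ> (f \<circ> inv_into (edges D) l)) {1..card (edges D)} {1..card (edges D)}"
    using l f unfolding labelling_def
    by (intro bij_betw_trans[OF bij_betw_trans[OF bij_betw_inv_into]])
  then have "bij_betw (\<lambda>i. if i \<in> {1..card (edges D)} then l (f (inv_into (edges D) l i)) else i)
    {1..card (edges D)} {1..card (edges D)}"
    by (subst bij_betw_cong[of _ _ "l \<circ> (f \<circ> inv_into (edges D) l)"]) simp_all
  then show ?thesis by (rule bij_imp_permutes) (rule if_not_P)
qed

lemma sigma_permutes: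
  assumes "is_dessin D" and "labelling D l"
  shows "sigma0 D l permutes {1..card (edges D)}" and "sigma1 D l permutes {1..card (edges D)}"
proof -
  have ends: "bend D e \<in> black D" "wend D e \<in> white D" if "e \<in> edges D" for e
    using assms(1) that by (auto simp: is_dessin_def)
  have ne: "bend D e \<noteq> wend D e'" if "e \<in> edges D" "e' \<in> edges D" for e e'
  proof -
    have "black D \<inter> white D = {}" using assms(1) by (simp add: is_dessin_def)
    then show ?thesis using ends(1)[OF that(1)] ends(2)[OF that(2)] by auto
  qed
  have "bij_betw (\<lambda>e. rot D (bend D e) e) (edges D) (edges D)"
    by (rule rot_bij_betw[OF assms(1)]) (use ends ne ne[symmetric] in \<open>auto simp: vertices_def star_def ends_def\<close>)
  from labelled_permutes[OF assms(2) this]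
  show "sigma0 D l permutes {1..card (edges D)}"
    unfolding sigma0_def[abs_def] Let_def .
  have "bij_betw (\<lambda>e. rot D (wend D e) e) (edges D) (edges D)"
    by (rule rot_bij_betw[OF assms(1)]) (use ends ne ne[symmetric] in \<open>auto simp: vertices_def star_def ends_def\<close>)
  from labelled_permutes[OF assms(2) this]
  show "sigma1 D l permutes {1..card (edges D)}"
    unfolding sigma1_def[abs_def] Let_def .
qed

definition wreath_Z2 :: "('a, 'm) monoid_scheme \<Rightarrow> ('a \<times> 'a \<times> int) monoid" where
  "wreath_Z2 H = \<lparr>
     carrier = carrier H \<times> carrier H \<times> carrier (integer_mod_group 2),
     monoid.mult = (\<lambda>(h1, h2, g) (k1, k2, g').
       let (k1', k2') = (if g = 0 then (k1, k2) else (k2, k1))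
       in (h1 \<otimes>\<^bsub>H\<^esub> k1', h2 \<otimes>\<^bsub>H\<^esub> k2', g \<otimes>\<^bsub>integer_mod_group 2\<^esub> g')),
     one = (\<one>\<^bsub>H\<^esub>, \<one>\<^bsub>H\<^esub>, \<one>\<^bsub>integer_mod_group 2\<^esub>)\<rparr>"

definition R2_carrier :: "nat \<Rightarrow> ((nat \<Rightarrow> nat) \<times> (nat \<Rightarrow> nat) \<times> int) set" where
  "R2_carrier m = {(\<tau>1, \<tau>2, g) \<in> carrier (wreath_Z2 (sym_group m)). evenperm (\<tau>1 \<circ> \<tau>2)}"

definition R2 :: "nat \<Rightarrow> ((nat \<Rightarrow> nat) \<times> (nat \<Rightarrow> nat) \<times> int) monoid" where
  "R2 m = (wreath_Z2 (sym_group m)) \<lparr>carrier := R2_carrier m\<rparr>"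

lemma carrier_integer_mod_group_2: "carrier (integer_mod_group 2) = {0, 1}"
  by (auto simp: carrier_integer_mod_group)

lemma wreath_Z2_mult:
  "(h1, h2, g) \<otimes>\<^bsub>wreath_Z2 H\<^esub> (k1, k2, g') =
     (if g = 0 then (h1 \<otimes>\<^bsub>H\<^esub> k1, h2 \<otimes>\<^bsub>H\<^esub> k2, (g + g') mod 2)
      else (h1 \<otimes>\<^bsub>H\<^esub> k2, h2 \<otimes>\<^bsub>H\<^esub> k1, (g + g') mod 2))"
  by (simp add: wreath_Z2_def integer_mod_group_def)

lemma wreath_Z2_carrier: "carrier (wreath_Z2 H) = carrier H \<times> carrier H \<times> {0, 1}"
  by (simp add: wreath_Z2_def carrier_integer_mod_group_2)

lemma wreath_Z2_one: "\<one>\<^bsub>wreath_Z2 H\<^esub> = (\<one>\<^bsub>H\<^esub>, \<one>\<^bsub>H\<^esub>, 0)"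
  by (simp add: wreath_Z2_def)

lemma group_wreath_Z2:
  assumes "group H"
  shows "group (wreath_Z2 H)"
proof -
  interpret H: group H by fact
  show ?thesis
  proof (rule groupI)
    show "x \<otimes>\<^bsub>wreath_Z2 H\<^esub> y \<in> carrier (wreath_Z2 H)"
      if "x \<in> carrier (wreath_Z2 H)" "y \<in> carrier (wreath_Z2 H)" for x y
      using that by (cases x; cases y) (auto simp: wreath_Z2_mult wreath_Z2_carrier)
    show "\<one>\<^bsub>wreath_Z2 H\<^esub> \<in> carrier (wreath_Z2 H)"
      by (simp add: wreath_Z2_carrier wreath_Z2_one)
    show "x \<otimes>\<^bsub>wreath_Z2 H\<^esub> y \<otimes>\<^bsub>wreath_Z2 H\<^esub> z = x \<otimes>\<^bsub>wreath_Z2 H\<^esub> (y \<otimes>\<^bsub>wreath_Z2 H\<^esub> z)"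
      if "x \<in> carrier (wreath_Z2 H)" "y \<in> carrier (wreath_Z2 H)" "z \<in> carrier (wreath_Z2 H)"
      for x y z
      using that
      by (cases x; cases y; cases z) (auto simp: wreath_Z2_mult wreath_Z2_carrier H.m_assoc)
    show "\<one>\<^bsub>wreath_Z2 H\<^esub> \<otimes>\<^bsub>wreath_Z2 H\<^esub> x = x" if "x \<in> carrier (wreath_Z2 H)" for x
      using that by (cases x) (auto simp: wreath_Z2_mult wreath_Z2_carrier wreath_Z2_one)
    show "\<exists>y \<in> carrier (wreath_Z2 H). y \<otimes>\<^bsub>wreath_Z2 H\<^esub> x = \<one>\<^bsub>wreath_Z2 H\<^esub>"
      if xc: "x \<in> carrier (wreath_Z2 H)" for x
    proof -
      obtain a b g where x: "x = (a, b, g)" "a \<in> carrier H" "b \<in> carrier H" "g \<in> {0, 1}"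
        using xc unfolding wreath_Z2_carrier by blast
      show ?thesis
        using x by (intro bexI[of _ "if g = 0 then (inv\<^bsub>H\<^esub> a, inv\<^bsub>H\<^esub> b, 0) else (inv\<^bsub>H\<^esub> b, inv\<^bsub>H\<^esub> a, 1)"])
          (auto simp: wreath_Z2_mult wreath_Z2_carrier wreath_Z2_one)
    qed
  qed
qed

text \<open>
  \<open>R2_carrier m\<close> is the only index 2 subgroup that contains the wreath product of the alternating
  group and an element \<open>(\<zeta>1, \<zeta>2, 0)\<close> with both \<open>\<zeta>1\<close> and \<open>\<zeta>2\<close> odd.
\<close>

lemma R2_carrier_iff:
  "(a, b, g) \<in> R2_carrier m \<longleftrightarrow>
     a permutes {1..m} \<and> b permutes {1..m} \<and> g \<in> {0, 1} \<and> (evenperm a \<longleftrightarrow> evenperm b)"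
proof -
  have "evenperm (a \<circ> b) \<longleftrightarrow> (evenperm a \<longleftrightarrow> evenperm b)"
    if "a permutes {1..m}" "b permutes {1..m}"
    using that by (intro evenperm_comp) (auto simp: permutation_permutes)
  then show ?thesis
    by (auto simp: R2_carrier_def wreath_Z2_carrier sym_group_carrier)
qed

lemma R2_subgroup: "subgroup (R2_carrier m) (wreath_Z2 (sym_group m))"
proof -
  interpret W: group "wreath_Z2 (sym_group m)"
    by (rule group_wreath_Z2[OF sym_group_is_group])
  have perm: "permutation p" if "p permutes {1..m}" for p
    using that permutation_permutes by blast
  have sub: "R2_carrier m \<subseteq> carrier (wreath_Z2 (sym_group m))" by (auto simp: R2_carrier_def)
  show ?thesis
  proof (rule W.subgroupI)
    show "R2_carrier m \<subseteq> carrier (wreath_Z2 (sym_group m))" by (rule sub)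
    show "R2_carrier m \<noteq> {}"
      using R2_carrier_iff[of id id 0 m] by (auto simp: permutes_id)
    show "a \<otimes>\<^bsub>wreath_Z2 (sym_group m)\<^esub> b \<in> R2_carrier m"
      if "a \<in> R2_carrier m" "b \<in> R2_carrier m" for a b
      using that
      by (cases a; cases b)
        (auto simp: wreath_Z2_mult R2_carrier_iff sym_group_mult permutes_compose evenperm_comp perm)
    show "inv\<^bsub>wreath_Z2 (sym_group m)\<^esub> x \<in> R2_carrier m" if "x \<in> R2_carrier m" for x
    proof -
      obtain a b g where x: "x = (a, b, g)" by (cases x)
      have ab: "a permutes {1..m}" "b permutes {1..m}" "g \<in> {0, 1}" "evenperm a \<longleftrightarrow> evenperm b"
        using that by (auto simp: x R2_carrier_iff)
      let ?y = "if g = 0 then (inv' a, inv' b, 0) else (inv' b, inv' a, 1)"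
      have y: "?y \<in> R2_carrier m"
        using ab by (auto simp: R2_carrier_iff permutes_inv evenperm_inv perm)
      have "?y \<otimes>\<^bsub>wreath_Z2 (sym_group m)\<^esub> x = \<one>\<^bsub>wreath_Z2 (sym_group m)\<^esub>"
        using ab by (auto simp: x wreath_Z2_mult wreath_Z2_one sym_group_mult sym_group_one permutes_inv_o)
      moreover have "x \<in> carrier (wreath_Z2 (sym_group m))" "?y \<in> carrier (wreath_Z2 (sym_group m))"
        using subsetD[OF sub that] subsetD[OF sub y] by auto
      ultimately have "inv\<^bsub>wreath_Z2 (sym_group m)\<^esub> x = ?y"
        by (rule W.inv_equality)
      with y show ?thesis by simp
    qed
  qed
qed

lemma R2_index:
  assumes "m \<ge> 2"
  shows "card (rcosets\<^bsub>wreath_Z2 (sym_group m)\<^esub> (R2_carrier m)) = 2"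
proof -
  let ?W = "wreath_Z2 (sym_group m)"
  interpret W: group ?W by (rule group_wreath_Z2[OF sym_group_is_group])
  let ?t = "transpose (1::nat) 2"
  have t: "?t permutes {1..m}" using assms by (auto intro: permutes_swap_id)
  have pt: "permutation ?t" by (rule permutation_swap_id)
  have odd_t: "\<not> evenperm ?t" by (simp add: evenperm_swap)
  have perm: "permutation p" if "p permutes {1..m}" for p
    using that permutation_permutes by blast
  let ?w = "(?t, id, 0::int)"
  have w: "?w \<in> carrier ?W"
    using t by (auto simp: wreath_Z2_carrier sym_group_carrier permutes_id)
  have w_notin: "?w \<notin> R2_carrier m" using odd_t by (auto simp: R2_carrier_iff)
  have coset: "R2_carrier m #>\<^bsub>?W\<^esub> x \<in> {R2_carrier m, R2_carrier m #>\<^bsub>?W\<^esub> ?w}"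
    if x: "x \<in> carrier ?W" for x
  proof (cases "x \<in> R2_carrier m")
    case True
    then show ?thesis by (simp add: R2_subgroup W.coset_join2 x)
  next
    case False
    obtain a b g where abg: "x = (a, b, g)" by (cases x)
    have ab: "a permutes {1..m}" "b permutes {1..m}" "g \<in> {0, 1}"
      using x by (auto simp: abg wreath_Z2_carrier sym_group_carrier)
    have ne: "evenperm a \<longleftrightarrow> \<not> evenperm b"
      using False ab by (auto simp: abg R2_carrier_iff)
    let ?k = "if g = 0 then (a \<circ> ?t, b, 0) else (a, b \<circ> ?t, 1::int)"
    have k: "?k \<in> R2_carrier m"
      using ab ne odd_t t by (auto simp: R2_carrier_iff permutes_compose evenperm_comp perm pt)
    have "x = ?k \<otimes>\<^bsub>?W\<^esub> ?w"
      using ab by (auto simp: abg wreath_Z2_mult sym_group_mult comp_assoc)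
    then have "x \<in> R2_carrier m #>\<^bsub>?W\<^esub> ?w"
      using k unfolding r_coset_def by blast
    then have "R2_carrier m #>\<^bsub>?W\<^esub> ?w = R2_carrier m #>\<^bsub>?W\<^esub> x"
      by (rule W.repr_independence[OF _ w R2_subgroup])
    then show ?thesis by simp
  qed
  have one: "R2_carrier m #>\<^bsub>?W\<^esub> \<one>\<^bsub>?W\<^esub> = R2_carrier m"
    by (rule W.coset_join2[OF W.one_closed R2_subgroup subgroup.one_closed[OF R2_subgroup]])
  have "rcosets\<^bsub>?W\<^esub> (R2_carrier m) = {R2_carrier m, R2_carrier m #>\<^bsub>?W\<^esub> ?w}"
  proof (rule equalityI; rule subsetI)
    show "C \<in> {R2_carrier m, R2_carrier m #>\<^bsub>?W\<^esub> ?w}" if C: "C \<in> rcosets\<^bsub>?W\<^esub> (R2_carrier m)" for C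
    proof -
      obtain x where "x \<in> carrier ?W" "C = R2_carrier m #>\<^bsub>?W\<^esub> x"
        using C unfolding RCOSETS_def by blast
      then show ?thesis using coset by simp
    qed
    have "R2_carrier m #>\<^bsub>?W\<^esub> x \<in> rcosets\<^bsub>?W\<^esub> (R2_carrier m)" if "x \<in> carrier ?W" for x
      using that unfolding RCOSETS_def by blast
    from this[OF W.one_closed] this[OF w]
    show "C \<in> rcosets\<^bsub>?W\<^esub> (R2_carrier m)" if "C \<in> {R2_carrier m, R2_carrier m #>\<^bsub>?W\<^esub> ?w}" for C
      using that one by auto
  qed
  moreover have "R2_carrier m \<noteq> R2_carrier m #>\<^bsub>?W\<^esub> ?w"
    using W.coset_join1[OF _ w R2_subgroup] w_notin by metis
  ultimately show ?thesis by simp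
qed

lemma R2_carrier_unique:
  assumes m: "m \<ge> 2"
  shows "subgroup K (wreath_Z2 (sym_group m)) \<and>
      card (rcosets\<^bsub>wreath_Z2 (sym_group m)\<^esub> K) = 2 \<and>
      carrier (wreath_Z2 (alt_group m)) \<subseteq> K \<and>
      (\<exists>\<zeta>1 \<zeta>2. (\<zeta>1, \<zeta>2, 0) \<in> K \<and> sign \<zeta>1 = -1 \<and> sign \<zeta>2 = -1)
    \<longleftrightarrow> K = R2_carrier m" (is "?L \<longleftrightarrow> _")
proof -
  let ?W = "wreath_Z2 (sym_group m)"
  interpret W: group ?W by (rule group_wreath_Z2[OF sym_group_is_group])
  let ?t = "transpose (1::nat) 2"
  have t: "?t permutes {1..m}" using m by (auto intro: permutes_swap_id)
  have odd_t: "\<not> evenperm ?t" by (simp add: evenperm_swap)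
  have perm: "permutation p" if "p permutes {1..m}" for p
    using that permutation_permutes by blast
  have fin: "finite (carrier ?W)"
    by (simp add: wreath_Z2_carrier sym_group_def finite_permutations)
  show ?thesis
  proof
    assume L: ?L
    then obtain \<zeta>1 \<zeta>2 where z: "(\<zeta>1, \<zeta>2, 0) \<in> K" "\<not> evenperm \<zeta>1" "\<not> evenperm \<zeta>2"
      by (auto simp: sign_def split: if_splits)
    have sub: "subgroup K ?W" and alt: "carrier (wreath_Z2 (alt_group m)) \<subseteq> K" using L by auto
    have zp: "\<zeta>1 permutes {1..m}" "\<zeta>2 permutes {1..m}"
      using subgroup.subset[OF sub] z(1) by (auto simp: wreath_Z2_carrier sym_group_carrier)
    have incl: "R2_carrier m \<subseteq> K"
    proof
      fix x assume x: "x \<in> R2_carrier m"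
      obtain a b g where abg: "x = (a, b, g)" by (cases x)
      have ab: "a permutes {1..m}" "b permutes {1..m}" "g \<in> {0, 1}" "evenperm a \<longleftrightarrow> evenperm b"
        using x by (auto simp: abg R2_carrier_iff)
      show "x \<in> K"
      proof (cases "evenperm a")
        case True
        then show ?thesis
          using ab alt by (auto simp: abg wreath_Z2_carrier alt_group_carrier)
      next
        case False
        let ?y = "(inv' \<zeta>1 \<circ> a, inv' \<zeta>2 \<circ> b, g)"
        have "?y \<in> carrier (wreath_Z2 (alt_group m))"
          using ab zp z False
          by (auto simp: wreath_Z2_carrier alt_group_carrier permutes_compose permutes_inv
              evenperm_comp evenperm_inv permutation_inverse perm)
        then have "?y \<in> K" using alt by blast
        moreover have "x = (\<zeta>1, \<zeta>2, 0) \<otimes>\<^bsub>?W\<^esub> ?y"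
          using ab zp by (auto simp: abg wreath_Z2_mult sym_group_mult comp_assoc[symmetric] permutes_inv_o)
        ultimately show ?thesis using subgroup.m_closed[OF sub z(1)] by simp
      qed
    qed
    have "card (R2_carrier m) * 2 = card K * 2"
      using W.lagrange_finite[OF fin sub] W.lagrange_finite[OF fin R2_subgroup] L R2_index[OF m]
      by simp
    moreover have "finite K" using subgroup.subset[OF sub] fin finite_subset by blast
    ultimately show "K = R2_carrier m" using incl card_subset_eq[of K "R2_carrier m"] by simp
  next
    assume K: "K = R2_carrier m"
    have "carrier (wreath_Z2 (alt_group m)) \<subseteq> K"
      by (auto simp: K wreath_Z2_carrier alt_group_carrier R2_carrier_iff)
    moreover have "(?t, ?t, 0) \<in> K" using t by (auto simp: K R2_carrier_iff)
    moreover have "sign ?t = -1" using odd_t by (simp add: sign_def)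
    ultimately show ?L
      unfolding K by (intro conjI R2_subgroup R2_index[OF m] exI[of _ ?t])
  qed
qed

end

theory Submission
  imports Defs
begin

text \<open>
  In a tree with this passport the white vertices are midpoints of the edges of a plane tree on the
  black vertices; only two black vertices \<open>p\<close> and \<open>q\<close>, of degrees \<open>r\<close> and \<open>t\<close>, are not leaves. By
  connectedness some white vertex joins \<open>p\<close> and \<open>q\<close>, and by acyclicity it is unique and all other
  white vertices join \<open>p\<close> or \<open>q\<close> to a leaf. Starting at this bridge and following the rotations
  around \<open>p\<close> and \<open>q\<close> numbers the edges in the same way in every such tree (\<open>edge_numbering\<close>).
  Hence the tree is unique.

  Put \<open>m = r + t - 1\<close>. The edges split into two halves of size \<open>m\<close>, according to the parity of
  half the distance of the black end from \<open>p\<close>; the rotation around white vertices interchanges the halves, and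
  it identifies each of them with the set of white vertices. On one half, the rotation around black
  vertices is an \<open>r\<close>-cycle \<open>\<alpha>\<close>, on the other half a \<open>t\<close>-cycle \<open>\<beta>\<close>, and the supports of \<open>\<alpha>\<close> and \<open>\<beta>\<close>
  share exactly one point, the bridge. So the monodromy group is isomorphic to the subgroup \<open>G\<close> of
  \<open>S\<^sub>m \<wr> \<int>/2\<close> generated by \<open>(\<alpha>, \<beta>, 0)\<close> and the swap \<open>(1, 1, 1)\<close> (\<open>monodromy_group_iso\<close>).

  The commutator of two permutations whose supports meet in one point is a three-cycle, and a
  permutation group that is normalized by \<open>\<alpha>\<close> and \<open>\<beta>\<close> and contains a three-cycle through the common
  point contains the alternating group (\<open>alternating_if_linked_point\<close>). If \<open>r \<noteq> t\<close>, then \<open>\<alpha>\<^sup>t\<close> or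
  \<open>\<beta>\<^sup>r\<close> is nontrivial, so a power of \<open>(\<alpha>, \<beta>, 0)\<close>, up to conjugation by the swap, is a nontrivial element
  of the first factor; its commutator with the other cycle is a three-cycle through the common point,
  so the intersection of \<open>G\<close> with the first factor contains \<open>A\<^sub>m\<close>. So \<open>G\<close> contains \<open>A\<^sub>m \<wr> \<int>/2\<close>, and the parities
  of \<open>\<alpha>\<close> and \<open>\<beta>\<close> decide which of the possible groups it is. If \<open>r = t\<close>, then an involution \<open>\<tau>\<close>
  interchanges \<open>\<alpha>\<close> and \<open>\<beta>\<close> by conjugation, the elements of \<open>G\<close> in the base group are the pairs
  \<open>(h, \<tau>h\<tau>)\<close> with \<open>h\<close> in the group generated by \<open>\<alpha>\<close> and \<open>\<beta>\<close>, which contains \<open>A\<^sub>m\<close>. This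
  group is all of \<open>S\<^sub>m\<close> if \<open>r\<close> is even, and if \<open>r\<close> is odd, then \<open>\<tau>\<close> is even; so it contains \<open>\<tau>\<close>, and
  \<open>(\<tau>, \<tau>, 1)\<close> is a central involution of \<open>G\<close> that splits off a factor \<open>\<int>/2\<close> (\<open>diagonal_iso\<close>).
\<close>

section \<open>Three-cycles in permutation groups\<close>

lemma three_cycle_apply:
  assumes "distinct [a, b, c]"
  shows "cycle_of_list [a, b, c] y = (if y = a then b else if y = b then c else if y = c then a else y)"
  using assms by (auto simp: transpose_def)

lemma three_cycle_support:
  assumes "distinct [a, b, c]"
  shows "{y. cycle_of_list [a, b, c] y \<noteq> y} = {a, b, c}"
  unfolding three_cycle_apply[OF assms] using assms by auto

lemma three_cycle_rotate:
  assumes "distinct [a, b, c]"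
  shows "cycle_of_list [b, c, a] = cycle_of_list [a, b, c]"
  using assms by (auto simp: fun_eq_iff transpose_def)

lemma three_cycle_square:
  assumes "distinct [a, b, c]"
  shows "cycle_of_list [a, b, c] \<circ> cycle_of_list [a, b, c] = cycle_of_list [a, c, b]"
  using assms by (auto simp: fun_eq_iff transpose_def)

text \<open>
  The source of all three-cycles below: two permutations whose supports meet in a single point have
  a three-cycle as commutator.
\<close>

lemma commutator_three_cycle:
  assumes p: "bij p" and q: "bij q" and supp: "{y. p y \<noteq> y} \<inter> {y. q y \<noteq> y} = {x}"
  shows "distinct [x, p x, q x]" and "p \<circ> q \<circ> inv' p \<circ> inv' q = cycle_of_list [x, p x, q x]"
proof -
  have x: "p x \<noteq> x" "q x \<noteq> x" using supp by auto
  have only: "q y = y" if "p y \<noteq> y" "y \<noteq> x" for y using supp that by blast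
  have only': "p y = y" if "q y \<noteq> y" "y \<noteq> x" for y using supp that by blast
  have injp: "p a = p b \<longleftrightarrow> a = b" for a b using p by (simp add: bij_is_inj inj_eq)
  have injq: "q a = q b \<longleftrightarrow> a = b" for a b using q by (simp add: bij_is_inj inj_eq)
  have ppx: "p (p x) \<noteq> p x" and qqx: "q (q x) \<noteq> q x" using x injp injq by auto
  have "p x \<noteq> q x" using ppx only'[of "q x"] qqx x by auto
  then show d: "distinct [x, p x, q x]" using x by auto
  show "p \<circ> q \<circ> inv' p \<circ> inv' q = cycle_of_list [x, p x, q x]"
  proof
    fix y
    obtain z where z: "y = q (p z)" using bij_is_surj[OF p] bij_is_surj[OF q] by (metis surjD)
    have "(p \<circ> q \<circ> inv' p \<circ> inv' q) y = p (q z)"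
      using z by (simp add: bij_is_inj[OF p] bij_is_inj[OF q])
    moreover have "cycle_of_list [x, p x, q x] (q (p z)) = p (q z)"
    proof (cases "z = x")
      case True
      then show ?thesis
        unfolding three_cycle_apply[OF d] using only[of "p x"] only'[of "q x"] ppx qqx x by simp
    next
      case zx: False
      show ?thesis
      proof (cases "p z = z")
        case pz: True
        have "z \<noteq> p x" "q z \<noteq> q x" using ppx pz zx injq by auto
        moreover have "p (q z) = q z \<and> q z \<noteq> p x" if "q z \<noteq> x" "q z \<noteq> z"
          using that only'[of "q z"] injq[of "q z" z] ppx by auto
        ultimately show ?thesis
          unfolding three_cycle_apply[OF d] using pz zx by (cases "q z = z") auto
      next
        case pz: False
        have qz: "q z = z" using only pz zx by simp
        have "q (p z) = p z \<and> p z \<noteq> q x" if "p z \<noteq> x"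
          using that only[of "p z"] injp[of "p z" z] pz qqx by auto
        then show ?thesis
          unfolding three_cycle_apply[OF d] using qz zx x d injp[of z x] by (cases "p z = x") auto
      qed
    qed
    ultimately show "(p \<circ> q \<circ> inv' p \<circ> inv' q) y = cycle_of_list [x, p x, q x] y"
      using z by simp
  qed
qed

text \<open>
  \<open>three_cycle_in N a b c\<close>: the three-cycle \<open>a \<mapsto> b \<mapsto> c \<mapsto> a\<close> is an element of \<open>N\<close>.
\<close>

definition three_cycle_in :: "('a \<Rightarrow> 'a) set \<Rightarrow> 'a \<Rightarrow> 'a \<Rightarrow> 'a \<Rightarrow> bool" where
  "three_cycle_in N a b c \<longleftrightarrow> distinct [a, b, c] \<and> cycle_of_list [a, b, c] \<in> N"

text \<open>
  Two points are linked if they are equal or lie in the support of a common three-cycle of \<open>N\<close>. If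
  \<open>N\<close> is a group, this is an equivalence relation; if all points are linked, then \<open>N\<close> contains all
  three-cycles.
\<close>

definition linked :: "('a \<Rightarrow> 'a) set \<Rightarrow> 'a \<Rightarrow> 'a \<Rightarrow> bool" where
  "linked N x y \<longleftrightarrow> x = y \<or> (\<exists>z. three_cycle_in N x y z)"

locale perm_subgroup =
  fixes n :: nat and N :: "(nat \<Rightarrow> nat) set"
  assumes subgroup: "subgroup N (sym_group n)"
begin

lemma permutes: "p \<in> N \<Longrightarrow> p permutes {1..n}"
  using subgroup.subset[OF subgroup] by (auto simp: sym_group_def)

lemma comp: "p \<in> N \<Longrightarrow> q \<in> N \<Longrightarrow> p \<circ> q \<in> N"
  using subgroup.m_closed[OF subgroup] by (simp add: sym_group_mult)

lemma inv: "p \<in> N \<Longrightarrow> inv' p \<in> N"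
  using subgroup.m_inv_closed[OF subgroup, of p] permutes[of p] by (simp add: sym_group_carrier)

lemma commutator: "p \<in> N \<Longrightarrow> q \<in> N \<Longrightarrow> p \<circ> q \<circ> inv' p \<circ> inv' q \<in> N"
  by (intro comp inv)

lemma three_cycle_in_rotate: "three_cycle_in N a b c \<Longrightarrow> three_cycle_in N b c a"
  using three_cycle_rotate[of a b c] unfolding three_cycle_in_def by auto

lemma three_cycle_in_swap: "three_cycle_in N a b c \<Longrightarrow> three_cycle_in N a c b"
  using three_cycle_square[of a b c] comp unfolding three_cycle_in_def by fastforce

lemma linked_sym: "linked N x y \<Longrightarrow> linked N y x"
  unfolding linked_def using three_cycle_in_swap[OF three_cycle_in_rotate] by blast

text \<open>
  If the two supports share only \<open>x\<close>, the wanted three-cycle is the commutator of the given ones; if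
  they share \<open>x\<close> and \<open>u = v\<close>, it arises by conjugation.
\<close>

lemma three_cycle_in_join:
  assumes xy: "three_cycle_in N x y u" and xz: "three_cycle_in N x z v" and "y \<noteq> z"
  shows "three_cycle_in N x y z"
proof -
  have *: ?thesis if "three_cycle_in N x z y"
    using that by (rule three_cycle_in_swap)
  have d: "distinct [x, y, u]" "distinct [x, z, v]" using xy xz by (auto simp: three_cycle_in_def)
  have c: "cycle_of_list [x, y, u] \<in> N" "cycle_of_list [x, z, v] \<in> N"
    using xy xz by (auto simp: three_cycle_in_def)
  have "u = z \<or> v = y \<or> u = v \<or> distinct [x, y, u, z, v]" using d \<open>y \<noteq> z\<close> by auto
  then consider "u = z" | "v = y" | "u = v" | "distinct [x, y, u, z, v]" by argo
  then show ?thesis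
  proof cases
    case 1
    then show ?thesis using xy by simp
  next
    case 2
    then show ?thesis using xz * by simp
  next
    case 3
    have dz: "distinct [x, z, u]" using d(2) 3 by simp
    have "cycle_of_list [x, z, u] \<circ> cycle_of_list [x, y, u] \<circ> inv' (cycle_of_list [x, z, u]) =
        cycle_of_list (map (cycle_of_list [x, z, u]) [x, y, u])"
      by (rule conjugation_of_cycle[OF d(1)]) (rule permutation_bijective[OF permutation_of_cycle])
    also have "map (cycle_of_list [x, z, u]) [x, y, u] = [z, y, x]"
      using d(1) dz \<open>y \<noteq> z\<close> by (simp only: list.map three_cycle_apply[OF dz]) simp
    finally have conj: "cycle_of_list [x, z, u] \<circ> cycle_of_list [x, y, u] \<circ>
        inv' (cycle_of_list [x, z, u]) = cycle_of_list [z, y, x]" .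
    have "cycle_of_list [x, z, u] \<in> N" using c(2) by (simp only: 3)
    with c(1) have "cycle_of_list [x, z, u] \<circ> cycle_of_list [x, y, u] \<circ>
        inv' (cycle_of_list [x, z, u]) \<in> N" by (intro comp inv)
    then have "cycle_of_list [z, y, x] \<in> N" unfolding conj .
    moreover have "distinct [z, y, x]" using d \<open>y \<noteq> z\<close> by auto
    ultimately have "three_cycle_in N z y x" unfolding three_cycle_in_def by blast
    then show ?thesis by (rule three_cycle_in_rotate[OF three_cycle_in_swap])
  next
    case 4
    let ?p = "cycle_of_list [x, y, u]" and ?q = "cycle_of_list [x, z, v]"
    have supp: "{w. ?p w \<noteq> w} \<inter> {w. ?q w \<noteq> w} = {x}"
      unfolding three_cycle_support[OF d(1)] three_cycle_support[OF d(2)] using 4 by auto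
    have bij: "bij ?p" "bij ?q" by (rule permutation_bijective[OF permutation_of_cycle])+
    have "?p x = y" "?q x = z" unfolding three_cycle_apply[OF d(1)] three_cycle_apply[OF d(2)] by simp_all
    with commutator_three_cycle(2)[OF bij supp] commutator[OF c]
    have "cycle_of_list [x, y, z] \<in> N" by (simp only:)
    then show ?thesis using 4 by (simp add: three_cycle_in_def)
  qed
qed

lemma linked_trans:
  assumes "linked N x y" "linked N y z"
  shows "linked N x z"
proof (cases "x = y \<or> y = z \<or> x = z")
  case True
  then show ?thesis using assms by (auto simp: linked_def)
next
  case False
  then obtain u v where uv: "three_cycle_in N y x u" "three_cycle_in N y z v"
    using assms linked_sym[OF assms(1)] by (auto simp: linked_def)
  have "three_cycle_in N y x z" using three_cycle_in_join[OF uv] False by simp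
  then show ?thesis unfolding linked_def using three_cycle_in_rotate by blast
qed

lemma alternating_if_linked:
  assumes "\<And>x y. x \<in> {1..n} \<Longrightarrow> y \<in> {1..n} \<Longrightarrow> linked N x y"
  shows "carrier (alt_group n) \<subseteq> N"
proof -
  interpret S: group "sym_group n" by (rule sym_group_is_group)
  have "three_cycles n \<subseteq> N"
  proof clarify
    fix cs :: "nat list" assume cs: "distinct cs" "length cs = 3" "set cs \<subseteq> {1..n}"
    obtain a b c where abc: "cs = [a, b, c]" using stupid_lemma[OF cs(2)] by blast
    have "linked N a b" "linked N a c" using cs(3) assms by (auto simp: abc)
    then obtain u v where uv: "three_cycle_in N a b u" "three_cycle_in N a c v"
      using cs(1) by (auto simp: abc linked_def)
    have "three_cycle_in N a b c" using three_cycle_in_join[OF uv] cs(1) by (simp add: abc)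
    then show "cycle_of_list cs \<in> N" by (simp add: abc three_cycle_in_def)
  qed
  then have "generate (sym_group n) (three_cycles n) \<subseteq> N"
    using S.generate_subgroup_incl subgroup by blast
  moreover have "generate (alt_group n) (three_cycles n) = generate (sym_group n) (three_cycles n)"
    using S.generate_consistent[OF three_cycles_incl alt_group_is_subgroup]
    by (simp add: alt_group_def)
  ultimately show ?thesis using alt_group_carrier_as_three_cycles by blast
qed

lemma linked_conj:
  assumes "bij p" and norm: "\<And>h. h \<in> N \<Longrightarrow> p \<circ> h \<circ> inv' p \<in> N" and "linked N x y"
  shows "linked N (p x) (p y)"
proof (cases "x = y")
  case False
  then obtain z where z: "distinct [x, y, z]" "cycle_of_list [x, y, z] \<in> N"
    using assms(3) by (auto simp: linked_def three_cycle_in_def)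
  have "cycle_of_list [p x, p y, p z] \<in> N"
    using norm[OF z(2)] conjugation_of_cycle[OF z(1) assms(1)] by simp
  moreover have "distinct [p x, p y, p z]"
    using z(1) bij_is_inj[OF assms(1)] by (auto simp: inj_eq)
  ultimately show ?thesis by (auto simp: linked_def three_cycle_in_def)
qed (simp add: linked_def)

lemma linked_funpow_orbit:
  assumes "bij p" and norm: "\<And>h. h \<in> N \<Longrightarrow> p \<circ> h \<circ> inv' p \<in> N" and "linked N x (p x)"
  shows "linked N x ((p ^^ k) x)"
proof (induction k)
  case (Suc k)
  have "linked N (p x) (p ((p ^^ k) x))" by (rule linked_conj[OF assms(1,2) Suc])
  then show ?case using linked_trans[OF assms(3)] by simp
qed (simp add: linked_def)

end

lemma cycle_of_list_nth:
  assumes "distinct cs" "i < length cs"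
  shows "cycle_of_list cs (cs ! i) = cs ! (Suc i mod length cs)"
proof -
  have "map (cycle_of_list cs ^^ 1) cs ! i = rotate 1 cs ! i"
    by (simp only: cyclic_rotation[OF assms(1)])
  then show ?thesis using assms(2) by (simp add: nth_rotate1)
qed

lemma cycle_of_list_hd_funpow:
  assumes "distinct cs" "k < length cs"
  shows "(cycle_of_list cs ^^ k) (cs ! 0) = cs ! k"
proof -
  have "map (cycle_of_list cs ^^ k) cs ! 0 = rotate k cs ! 0"
    by (simp add: cyclic_rotation[OF assms(1)])
  then show ?thesis using assms(2) by (cases cs) (simp_all add: nth_rotate)
qed

lemma cycle_of_list_funpow_moves:
  assumes "distinct cs" "\<not> length cs dvd k" "y \<in> set cs"
  shows "(cycle_of_list cs ^^ k) y \<noteq> y"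
proof -
  obtain i where i: "i < length cs" "y = cs ! i" using assms(3) by (auto simp: in_set_conv_nth)
  have "map (cycle_of_list cs ^^ k) cs ! i = rotate k cs ! i"
    by (simp only: cyclic_rotation[OF assms(1)])
  then have "(cycle_of_list cs ^^ k) y = cs ! ((k + i) mod length cs)" using i by (simp add: nth_rotate)
  moreover have "(k + i) mod length cs < length cs" using i(1) by (intro mod_less_divisor) linarith
  moreover have "(k + i) mod length cs \<noteq> i"
  proof
    assume "(k + i) mod length cs = i"
    then have "(k + i) mod length cs = (0 + i) mod length cs" using i(1) by simp
    then have "length cs dvd (k + i) - (0 + i)"
      by (intro mod_eq_dvd_iff_nat[THEN iffD1]) simp_all
    then show False using assms(2) by simp
  qed
  ultimately show ?thesis using i assms(1) nth_eq_iff_index_eq by metis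
qed

lemma cycle_of_list_moves:
  assumes "distinct cs" "length cs > 1" "y \<in> set cs"
  shows "cycle_of_list cs y \<noteq> y"
  using cycle_of_list_funpow_moves[of cs 1 y] assms by simp

lemma evenperm_cycle_of_list:
  assumes "distinct cs" "cs \<noteq> []"
  shows "evenperm (cycle_of_list cs) \<longleftrightarrow> odd (length cs)"
proof (rule evenperm_unique[OF swapidseq_ext_imp_swapidseq[OF swapidseq_ext_of_cycles[OF assms(1)]]])
  show "even (length cs - 1) = odd (length cs)" using assms(2) by (cases cs) auto
qed

lemma cyclic_on_cycle_of_list:
  assumes "distinct cs" "cs \<noteq> []"
  shows "cyclic_on (cycle_of_list cs) (set cs)"
proof -
  have "orbit (cycle_of_list cs) (cs ! 0) = set cs"
  proof
    show "orbit (cycle_of_list cs) (cs ! 0) \<subseteq> set cs"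
      using assms(2) by (intro permutes_orbit_subset[OF cycle_permutes]) simp
    show "set cs \<subseteq> orbit (cycle_of_list cs) (cs ! 0)"
    proof
      fix y assume "y \<in> set cs"
      then obtain k where "k < length cs" "y = cs ! k" by (auto simp: in_set_conv_nth)
      then have "y = (cycle_of_list cs ^^ k) (cs ! 0)"
        using cycle_of_list_hd_funpow[OF assms(1)] by simp
      then show "y \<in> orbit (cycle_of_list cs) (cs ! 0)"
        by (auto simp: orbit_altdef_permutation[OF permutation_of_cycle])
    qed
  qed
  then show ?thesis using assms(2) by (intro cyclic_on_singleI[of "cs ! 0"]) simp_all
qed


section \<open>Two cycles with one common point\<close>

context perm_subgroup
begin

text \<open>
  A point \<open>b\<close> that the cycle fixes but that is linked to \<open>x\<close> is linked to the successor of \<open>x\<close> as well,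
  and so \<open>x\<close> is linked to its successor; iteration reaches the whole cycle.
\<close>

lemma linked_cycle:
  assumes "distinct (x # as)" "b \<notin> set (x # as)" "linked N x b"
    and norm: "\<And>h. h \<in> N \<Longrightarrow> cycle_of_list (x # as) \<circ> h \<circ> inv' (cycle_of_list (x # as)) \<in> N"
    and a: "a \<in> set (x # as)"
  shows "linked N x a"
proof -
  let ?p = "cycle_of_list (x # as)"
  have bij: "bij ?p" by (rule permutation_bijective[OF permutation_of_cycle])
  have "linked N (?p x) (?p b)" by (rule linked_conj[OF bij norm assms(3)])
  then have "linked N (?p x) b" using id_outside_supp[OF assms(2)] by simp
  then have step: "linked N x (?p x)" using assms(3) linked_sym linked_trans by blast
  obtain k where "k < length (x # as)" "a = (x # as) ! k" using a by (metis in_set_conv_nth)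
  then have "a = (?p ^^ k) x" using cycle_of_list_hd_funpow[OF assms(1), of k] by simp
  then show ?thesis using linked_funpow_orbit[OF bij norm step] by simp
qed

end

lemma wreath_Z2_sym_carrier:
  "(a, b, g) \<in> carrier (wreath_Z2 (sym_group n)) \<longleftrightarrow>
     a permutes {1..n} \<and> b permutes {1..n} \<and> g \<in> {0, 1}"
  by (simp add: wreath_Z2_carrier sym_group_carrier)

text \<open>
  Two cycles \<open>alpha = (x, as)\<close> and \<open>beta = (x, bs)\<close> on the points \<open>1, \<dots>, n\<close> whose only common point
  is \<open>x\<close> and whose supports cover all points.
\<close>

locale two_cycles =
  fixes n :: nat and x :: nat and as bs :: "nat list"
  assumes distinct: "distinct (x # as @ bs)" and support: "set (x # as @ bs) = {1..n}"
    and nonempty: "as \<noteq> []" "bs \<noteq> []"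
begin

definition alpha :: "nat \<Rightarrow> nat" where "alpha = cycle_of_list (x # as)"
definition beta :: "nat \<Rightarrow> nat" where "beta = cycle_of_list (x # bs)"

lemma support_iff: "y \<in> {1..n} \<longleftrightarrow> y = x \<or> y \<in> set as \<or> y \<in> set bs"
  unfolding support[symmetric] by simp

lemma sym: "two_cycles n x bs as"
  using distinct support nonempty by unfold_locales auto

lemma alpha_permutes: "alpha permutes {1..n}"
  unfolding alpha_def using support by (intro permutes_subset[OF cycle_permutes]) auto

lemma beta_permutes: "beta permutes {1..n}"
  unfolding beta_def using support by (intro permutes_subset[OF cycle_permutes]) auto

text \<open>
  \<open>N\<close> need not contain the two cycles; it suffices that they normalize it. Linking \<open>x\<close> to one other
  point \<open>q\<close> propagates first along the cycle that avoids \<open>q\<close> and then along the other one.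
\<close>

lemma alternating_if_linked_point:
  assumes "perm_subgroup n N"
    and alpha: "\<And>h. h \<in> N \<Longrightarrow> alpha \<circ> h \<circ> inv' alpha \<in> N"
    and beta: "\<And>h. h \<in> N \<Longrightarrow> beta \<circ> h \<circ> inv' beta \<in> N"
    and q: "q \<noteq> x" "q \<in> {1..n}" "linked N x q"
  shows "carrier (alt_group n) \<subseteq> N"
proof -
  interpret perm_subgroup n N by fact
  have across_as: "linked N x a" if "b \<in> set bs" "linked N x b" "a \<in> set (x # as)" for a b
    using linked_cycle[of x as b a] that distinct alpha unfolding alpha_def by auto
  have across_bs: "linked N x b" if "a \<in> set as" "linked N x a" "b \<in> set (x # bs)" for a b
    using linked_cycle[of x bs a b] that distinct beta unfolding beta_def by auto
  obtain a b where ab: "a \<in> set as" "b \<in> set bs" using last_in_set[OF nonempty(1)] last_in_set[OF nonempty(2)] by blast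
  have "linked N x a \<and> linked N x b"
  proof (cases "q \<in> set as")
    case True
    have b: "linked N x b" by (rule across_bs[OF True q(3)]) (use ab in simp)
    have "linked N x a" by (rule across_as[OF ab(2) b]) (use ab in simp)
    with b show ?thesis by simp
  next
    case False
    then have "q \<in> set bs" using q(1,2) unfolding support_iff by blast
    then have a: "linked N x a" by (rule across_as[OF _ q(3)]) (use ab in simp)
    have "linked N x b" by (rule across_bs[OF ab(1) a]) (use ab in simp)
    with a show ?thesis by simp
  qed
  then have all: "linked N x y" if "y \<in> {1..n}" for y
    using across_as[OF ab(2), of y] across_bs[OF ab(1), of y] that unfolding support_iff by auto
  show ?thesis
    by (rule alternating_if_linked) (rule linked_trans[OF linked_sym[OF all] all])
qed

text \<open>
  Here \<open>p\<close> will be \<open>alpha\<close> or a power of it, so that \<open>x\<close> is the only point moved by both \<open>p\<close> and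
  \<open>beta\<close>.
\<close>

lemma commutator_linked:
  assumes "bij p" and fixes_outside: "\<And>y. y \<notin> set (x # as) \<Longrightarrow> p y = y" and moves: "p x \<noteq> x"
    and "p \<circ> beta \<circ> inv' p \<circ> inv' beta \<in> N"
  shows "linked N x (p x)"
proof -
  have "beta x \<noteq> x"
    unfolding beta_def using distinct nonempty by (intro cycle_of_list_moves) auto
  moreover have "beta y = y" if "y \<notin> set (x # bs)" for y
    unfolding beta_def by (rule id_outside_supp[OF that])
  ultimately have supp: "{y. p y \<noteq> y} \<inter> {y. beta y \<noteq> y} = {x}"
    using fixes_outside moves distinct by auto
  have bij: "bij beta" unfolding beta_def by (rule permutation_bijective[OF permutation_of_cycle])
  from commutator_three_cycle[OF \<open>bij p\<close> bij supp] assms(4)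
  show ?thesis unfolding linked_def three_cycle_in_def by metis
qed

lemma alpha_in_bounds: "alpha x \<noteq> x" "alpha x \<in> {1..n}"
proof -
  show "alpha x \<noteq> x"
    unfolding alpha_def using distinct nonempty by (intro cycle_of_list_moves) auto
  show "alpha x \<in> {1..n}" using permutes_in_image[OF alpha_permutes] support by auto
qed

lemma alternating_if_generators:
  assumes "perm_subgroup n N" "alpha \<in> N" "beta \<in> N"
  shows "carrier (alt_group n) \<subseteq> N"
proof -
  interpret perm_subgroup n N by fact
  have "linked N x (alpha x)"
  proof (rule commutator_linked[where p = alpha])
    show "bij alpha" using alpha_permutes by (rule permutes_bij)
    show "alpha y = y" if "y \<notin> set (x # as)" for y
      unfolding alpha_def by (rule id_outside_supp[OF that])
    show "alpha x \<noteq> x" by (rule alpha_in_bounds)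
    show "alpha \<circ> beta \<circ> inv' alpha \<circ> inv' beta \<in> N" using assms by (intro commutator)
  qed
  then show ?thesis
    using assms by (intro alternating_if_linked_point[OF assms(1) _ _ alpha_in_bounds] comp inv)
qed

end

section \<open>Subgroups of the wreath product that contain the swap\<close>

text \<open>
  A subgroup of the wreath product of the symmetric group with \<open>\<int>/2\<close> that contains the element
  interchanging the two factors. It is determined by its elements with trivial third component.
\<close>

locale swap_subgroup =
  fixes n :: nat and G :: "((nat \<Rightarrow> nat) \<times> (nat \<Rightarrow> nat) \<times> int) set"
  assumes subgroup: "subgroup G (wreath_Z2 (sym_group n))" and swap: "(id, id, 1) \<in> G"
begin

sublocale W: group "wreath_Z2 (sym_group n)"
  by (rule group_wreath_Z2[OF sym_group_is_group])

lemma permutes: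
  assumes "(a, b, g) \<in> G"
  shows "a permutes {1..n}" "b permutes {1..n}" "g \<in> {0, 1}"
  using subsetD[OF subgroup.subset[OF subgroup] assms] by (simp_all add: wreath_Z2_sym_carrier)

lemma mult: "(a, b, 0) \<in> G \<Longrightarrow> (c, d, 0) \<in> G \<Longrightarrow> (a \<circ> c, b \<circ> d, 0) \<in> G"
  using subgroup.m_closed[OF subgroup, of "(a, b, 0)" "(c, d, 0)"]
  by (simp add: wreath_Z2_mult sym_group_mult)

lemma inverse:
  assumes ab: "(a, b, 0) \<in> G"
  shows "(inv' a, inv' b, 0) \<in> G"
proof -
  have p: "a permutes {1..n}" "b permutes {1..n}" using permutes[OF ab] by auto
  have "inv\<^bsub>wreath_Z2 (sym_group n)\<^esub> (a, b, 0) = (inv' a, inv' b, 0)"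
    using p by (intro W.inv_equality)
      (auto simp: wreath_Z2_mult wreath_Z2_one sym_group_mult sym_group_one permutes_inv_o
        permutes_inv wreath_Z2_sym_carrier)
  then show ?thesis using subgroup.m_inv_closed[OF subgroup ab] by simp
qed

lemma flip:
  assumes ab: "(a, b, 0) \<in> G"
  shows "(b, a, 0) \<in> G"
  using subgroup.m_closed[OF subgroup subgroup.m_closed[OF subgroup swap ab] swap]
  by (simp add: wreath_Z2_mult sym_group_mult)

lemma with_swap_iff: "(a, b, 1) \<in> G \<longleftrightarrow> (a, b, 0) \<in> G"
proof
  show "(a, b, 1) \<in> G" if "(a, b, 0) \<in> G"
    using subgroup.m_closed[OF subgroup that swap] by (simp add: wreath_Z2_mult sym_group_mult)
  show "(a, b, 0) \<in> G" if "(a, b, 1) \<in> G"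
    using subgroup.m_closed[OF subgroup that swap] by (simp add: wreath_Z2_mult sym_group_mult)
qed

lemma one: "(id, id, 0) \<in> G"
  using subgroup.one_closed[OF subgroup] by (simp add: wreath_Z2_one sym_group_one)

lemma funpow: "(a, b, 0) \<in> G \<Longrightarrow> (a ^^ k, b ^^ k, 0) \<in> G"
  by (induction k) (simp_all add: one[unfolded id_def] one mult)

text \<open>
  The intersection of \<open>G\<close> with the first factor of the base group.
\<close>

definition first_factor :: "(nat \<Rightarrow> nat) set" where
  "first_factor = {p. (p, id, 0) \<in> G}"

lemma first_factor: "perm_subgroup n first_factor"
proof (rule perm_subgroup.intro)
  interpret S: group "sym_group n" by (rule sym_group_is_group)
  show "subgroup first_factor (sym_group n)"
  proof (rule S.subgroupI)
    show "first_factor \<subseteq> carrier (sym_group n)"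
      using permutes by (auto simp: first_factor_def sym_group_carrier)
    show "first_factor \<noteq> {}" using one by (auto simp: first_factor_def)
    show "inv\<^bsub>sym_group n\<^esub> p \<in> first_factor" if "p \<in> first_factor" for p
      using that inverse[of p id] permutes[of p id 0] by (simp add: first_factor_def sym_group_carrier inv_id)
    show "p \<otimes>\<^bsub>sym_group n\<^esub> q \<in> first_factor" if "p \<in> first_factor" "q \<in> first_factor" for p q
      using that mult[of p id q id] by (simp add: first_factor_def sym_group_mult)
  qed
qed

text \<open>
  The first component of any element of the base group that lies in \<open>G\<close> normalizes the first factor.
\<close>

lemma first_factor_normal:
  assumes "(a, b, 0) \<in> G" "p \<in> first_factor"
  shows "a \<circ> p \<circ> inv' a \<in> first_factor"
  using mult[OF mult[OF assms(1), of p id] inverse[OF assms(1)]] assms(2) permutes[OF assms(1)]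
  by (simp add: first_factor_def permutes_inv_o)

lemma first_factor_prod:
  assumes "p \<in> first_factor" "q \<in> first_factor" "g \<in> {0, 1}"
  shows "(p, q, g) \<in> G"
proof -
  have "(p \<circ> id, id \<circ> q, 0) \<in> G"
    using assms by (intro mult flip[of q]) (simp_all add: first_factor_def)
  then show ?thesis using with_swap_iff assms(3) by auto
qed

end

section \<open>The subgroup generated by two cycles and the swap\<close>

context two_cycles
begin

text \<open>
  If the length of \<open>alpha\<close> does not divide the length \<open>d\<close> of \<open>beta\<close>, then the \<open>d\<close>-th power of
  \<open>(alpha, beta)\<close> is a nontrivial element of the first factor, and it moves \<open>x\<close>.
\<close>

lemma alternating_if_power:
  assumes "swap_subgroup n G" and gen: "(alpha, beta, 0) \<in> G"
    and ndvd: "\<not> Suc (length as) dvd Suc (length bs)"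
  shows "carrier (alt_group n) \<subseteq> swap_subgroup.first_factor G"
proof -
  interpret swap_subgroup n G by fact
  interpret N: perm_subgroup n first_factor by (rule first_factor)
  let ?p = "alpha ^^ Suc (length bs)"
  have "beta ^^ Suc (length bs) = id"
    using cycle_is_id_root[of "x # bs"] distinct by (simp add: beta_def del: cycle_of_list.simps funpow.simps)
  then have p: "?p \<in> first_factor"
    using funpow[OF gen, of "Suc (length bs)"] by (simp add: first_factor_def del: funpow.simps)
  have moves: "?p x \<noteq> x"
    unfolding alpha_def using distinct ndvd by (intro cycle_of_list_funpow_moves) auto
  have norm: "alpha \<circ> h \<circ> inv' alpha \<in> first_factor" "beta \<circ> h \<circ> inv' beta \<in> first_factor"
    if "h \<in> first_factor" for h
    using first_factor_normal[OF gen that] first_factor_normal[OF flip[OF gen] that] by auto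
  have "linked first_factor x (?p x)"
  proof (rule commutator_linked[where p = ?p])
    show "bij ?p" using N.permutes[OF p] by (rule permutes_bij)
    show "?p y = y" if "y \<notin> set (x # as)" for y
    proof -
      have "alpha y = y" unfolding alpha_def by (rule id_outside_supp[OF that])
      then have "(alpha ^^ k) y = y" for k by (induction k) simp_all
      then show ?thesis .
    qed
    show "?p x \<noteq> x" by (rule moves)
    \<comment> \<open>\<open>beta\<close> need not lie in the first factor, but it normalizes it\<close>
    have "?p \<circ> (beta \<circ> inv' ?p \<circ> inv' beta) \<in> first_factor"
      by (rule N.comp[OF p norm(2)[OF N.inv[OF p]]])
    then show "?p \<circ> beta \<circ> inv' ?p \<circ> inv' beta \<in> first_factor" by (simp only: comp_assoc)
  qed
  moreover have "?p x \<in> {1..n}" using permutes_in_image[OF N.permutes[OF p]] support by auto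
  ultimately show ?thesis
    using norm moves by (intro alternating_if_linked_point[OF first_factor]) 
qed

lemma alternating_first_factor:
  assumes "swap_subgroup n G" and gen: "(alpha, beta, 0) \<in> G"
    and ne: "length as \<noteq> length bs"
  shows "carrier (alt_group n) \<subseteq> swap_subgroup.first_factor G"
proof (cases "Suc (length as) dvd Suc (length bs)")
  case False
  then show ?thesis using assms by (intro alternating_if_power)
next
  case True
  interpret swap_subgroup n G by fact
  interpret flipped: two_cycles n x bs as by (rule sym)
  \<comment> \<open>the previous lemma applies with the two cycles interchanged\<close>
  have "\<not> Suc (length bs) dvd Suc (length as)" using True ne dvd_antisym[of "Suc (length as)" "Suc (length bs)"] by auto
  moreover have "(flipped.alpha, flipped.beta, 0) \<in> G"
    using flip[OF gen] unfolding flipped.alpha_def flipped.beta_def alpha_def beta_def .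
  ultimately show ?thesis using flipped.alternating_if_power[OF assms(1)] by blast
qed

lemma evenperm_alpha: "evenperm alpha \<longleftrightarrow> even (length as)"
  unfolding alpha_def using distinct by (subst evenperm_cycle_of_list) auto

lemma evenperm_beta: "evenperm beta \<longleftrightarrow> even (length bs)"
  unfolding beta_def using distinct by (subst evenperm_cycle_of_list) auto

text \<open>
  These two elements correspond to the rotations around the black and around the white vertices.
\<close>

definition wreath_gens :: "((nat \<Rightarrow> nat) \<times> (nat \<Rightarrow> nat) \<times> int) set" where
  "wreath_gens = {(alpha, beta, 0), (id, id, 1)}"

lemma wreath_gens_carrier: "wreath_gens \<subseteq> carrier (wreath_Z2 (sym_group n))"
  using alpha_permutes beta_permutes
  by (auto simp: wreath_gens_def wreath_Z2_sym_carrier permutes_id)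

abbreviation wreath_gen :: "((nat \<Rightarrow> nat) \<times> (nat \<Rightarrow> nat) \<times> int) set" where
  "wreath_gen \<equiv> generate (wreath_Z2 (sym_group n)) wreath_gens"

lemma swap_subgroup_wreath_gen: "swap_subgroup n wreath_gen"
proof (rule swap_subgroup.intro)
  interpret W: group "wreath_Z2 (sym_group n)" by (rule group_wreath_Z2[OF sym_group_is_group])
  show "subgroup wreath_gen (wreath_Z2 (sym_group n))"
    by (rule W.generate_is_subgroup[OF wreath_gens_carrier])
  show "(id, id, 1) \<in> wreath_gen" by (rule generate.incl) (simp add: wreath_gens_def)
qed

lemma generator: "(alpha, beta, 0) \<in> wreath_gen"
  by (rule generate.incl) (simp add: wreath_gens_def)

lemma wreath_gen_subset:
  assumes "subgroup K (wreath_Z2 (sym_group n))" "wreath_gens \<subseteq> K"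
  shows "wreath_gen \<subseteq> K"
  by (rule group.generate_subgroup_incl[OF group_wreath_Z2[OF sym_group_is_group] assms(2,1)])

lemma subgroup_wreath_alt: "subgroup (carrier (wreath_Z2 (alt_group n))) (wreath_Z2 (sym_group n))"
proof -
  interpret W: group "wreath_Z2 (sym_group n)" by (rule group_wreath_Z2[OF sym_group_is_group])
  have "wreath_Z2 (alt_group n) = (wreath_Z2 (sym_group n))\<lparr>carrier := carrier (wreath_Z2 (alt_group n))\<rparr>"
    by (simp add: wreath_Z2_def alt_group_def sym_group_def)
  then have "group ((wreath_Z2 (sym_group n))\<lparr>carrier := carrier (wreath_Z2 (alt_group n))\<rparr>)"
    using group_wreath_Z2[OF alt_group_is_group, of n] by simp
  then show ?thesis
    by (intro W.group_incl_imp_subgroup)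
      (auto simp: wreath_Z2_carrier alt_group_carrier sym_group_carrier)
qed

text \<open>
  In the next three lemmas the parities are those of the lengths of \<open>as\<close> and \<open>bs\<close>, which are one less
  than the lengths of the cycles.
\<close>

lemma wreath_gen_odd_odd:
  assumes ne: "length as \<noteq> length bs" and "even (length as)" "even (length bs)"
  shows "wreath_gen = carrier (wreath_Z2 (alt_group n))"
proof
  interpret swap_subgroup n wreath_gen by (rule swap_subgroup_wreath_gen)
  have alt: "carrier (alt_group n) \<subseteq> first_factor"
    by (rule alternating_first_factor[OF swap_subgroup_wreath_gen generator ne])
  show "wreath_gen \<subseteq> carrier (wreath_Z2 (alt_group n))"
    using assms alpha_permutes beta_permutes evenperm_alpha evenperm_beta
    by (intro wreath_gen_subset[OF subgroup_wreath_alt])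
      (auto simp: wreath_gens_def wreath_Z2_carrier alt_group_carrier permutes_id)
  show "carrier (wreath_Z2 (alt_group n)) \<subseteq> wreath_gen"
    using subsetD[OF alt] first_factor_prod by (force simp: wreath_Z2_carrier)
qed

lemma wreath_gen_even_even:
  assumes ne: "length as \<noteq> length bs" and "odd (length as)" "odd (length bs)"
  shows "wreath_gen = R2_carrier n"
proof
  interpret swap_subgroup n wreath_gen by (rule swap_subgroup_wreath_gen)
  have alt: "carrier (alt_group n) \<subseteq> first_factor"
    by (rule alternating_first_factor[OF swap_subgroup_wreath_gen generator ne])
  have perm: "permutation p" if "p permutes {1..n}" for p
    using that permutation_permutes by blast
  show "wreath_gen \<subseteq> R2_carrier n"
    using assms alpha_permutes beta_permutes evenperm_alpha evenperm_beta
    by (intro wreath_gen_subset[OF R2_subgroup])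
      (auto simp: wreath_gens_def R2_carrier_iff permutes_id)
  show "R2_carrier n \<subseteq> wreath_gen"
  proof
    fix z assume z: "z \<in> R2_carrier n"
    obtain a b g where abg: "z = (a, b, g)" by (cases z)
    have ab: "a permutes {1..n}" "b permutes {1..n}" "g \<in> {0, 1}" "evenperm a \<longleftrightarrow> evenperm b"
      using z by (auto simp: abg R2_carrier_iff)
    have "(a, b, 0) \<in> wreath_gen"
    proof (cases "evenperm a")
      case True
      then show ?thesis using ab alt by (intro first_factor_prod) (auto simp: alt_group_carrier)
    next
      case False
      \<comment> \<open>both cycles are odd, so dividing by them makes both components even\<close>
      have "inv' alpha \<circ> a \<in> carrier (alt_group n)" "inv' beta \<circ> b \<in> carrier (alt_group n)"
        using False ab assms alpha_permutes beta_permutes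
        by (auto simp: alt_group_carrier permutes_compose permutes_inv evenperm_comp evenperm_inv
            permutation_inverse perm evenperm_alpha evenperm_beta)
      then have "(inv' alpha \<circ> a, inv' beta \<circ> b, 0) \<in> wreath_gen"
        using alt by (intro first_factor_prod) auto
      from mult[OF generator this] show ?thesis
        using alpha_permutes beta_permutes by (simp add: comp_assoc[symmetric] permutes_inv_o)
    qed
    then show "z \<in> wreath_gen" using ab(3) with_swap_iff by (auto simp: abg)
  qed
qed

lemma wreath_gen_mixed:
  assumes parity: "even (length as) \<longleftrightarrow> odd (length bs)"
  shows "wreath_gen = carrier (wreath_Z2 (sym_group n))"
proof
  interpret swap_subgroup n wreath_gen by (rule swap_subgroup_wreath_gen)
  interpret N: perm_subgroup n first_factor by (rule first_factor)
  have ne: "length as \<noteq> length bs" using parity by auto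
  have alt: "carrier (alt_group n) \<subseteq> first_factor"
    by (rule alternating_first_factor[OF swap_subgroup_wreath_gen generator ne])
  have perm: "permutation p" if "p permutes {1..n}" for p
    using that permutation_permutes by blast
  \<comment> \<open>The even component can be divided out, which leaves an odd element of the first factor.\<close>
  have "\<exists>c d. (c, d, 0) \<in> wreath_gen \<and> \<not> evenperm c \<and> evenperm d"
    using generator flip[OF generator] parity evenperm_alpha evenperm_beta by blast
  then obtain c d where cd: "(c, d, 0) \<in> wreath_gen" "\<not> evenperm c" "evenperm d" by blast
  have c: "c permutes {1..n}" and d: "d permutes {1..n}" using permutes[OF cd(1)] by auto
  have "d \<in> first_factor" using alt cd(3) d by (auto simp: alt_group_carrier)
  then have "(id, inv' d, 0) \<in> wreath_gen"
    using N.inv by (intro flip[of "inv' d"]) (simp add: first_factor_def)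
  then have c_in: "c \<in> first_factor"
    using mult[OF cd(1)] permutes_inv_o(1)[OF d] by (force simp: first_factor_def)
  have sym: "p \<in> first_factor" if p: "p permutes {1..n}" for p
  proof (cases "evenperm p")
    case True
    then show ?thesis using p alt by (auto simp: alt_group_carrier)
  next
    case False
    then have "inv' c \<circ> p \<in> carrier (alt_group n)"
      using p c cd(2) by (auto simp: alt_group_carrier permutes_compose permutes_inv evenperm_comp
          evenperm_inv permutation_inverse perm)
    then have "c \<circ> (inv' c \<circ> p) \<in> first_factor" using subsetD[OF alt] by (intro N.comp[OF c_in])
    then show ?thesis using c by (simp add: comp_assoc[symmetric] permutes_inv_o)
  qed
  show "wreath_gen \<subseteq> carrier (wreath_Z2 (sym_group n))" by (rule subgroup.subset[OF subgroup])
  show "carrier (wreath_Z2 (sym_group n)) \<subseteq> wreath_gen"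
    using sym first_factor_prod by (auto simp: wreath_Z2_carrier sym_group_carrier)
qed

end

section \<open>Cycles of equal length\<close>

text \<open>
  The product of the transpositions of corresponding entries of two lists; for disjoint lists of equal
  length it is the involution that interchanges them entry by entry.
\<close>

definition swap_lists :: "'a list \<Rightarrow> 'a list \<Rightarrow> 'a \<Rightarrow> 'a" where
  "swap_lists as bs = apply_transps (zip as bs)"

lemma swap_lists_Cons: "swap_lists (a # as) (b # bs) = transpose a b \<circ> swap_lists as bs"
  by (simp add: swap_lists_def)

lemma swap_lists_outside:
  "y \<notin> set as \<union> set bs \<Longrightarrow> swap_lists as bs y = y"
proof (induction as bs rule: list_induct2')
  case (4 a as b bs)
  then show ?case by (simp add: swap_lists_Cons)
qed (simp_all add: swap_lists_def)

lemma swap_lists_map: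
  assumes "length as = length bs" "distinct (as @ bs)"
  shows "map (swap_lists as bs) as = bs \<and> map (swap_lists as bs) bs = as"
  using assms
proof (induction as bs rule: list_induct2)
  case Nil
  then show ?case by simp
next
  case (Cons a as b bs)
  have "swap_lists as bs a = a" "swap_lists as bs b = b"
    using Cons.prems by (auto intro!: swap_lists_outside)
  moreover have "map (transpose a b) as = as" "map (transpose a b) bs = bs"
    using Cons.prems by (auto intro!: map_idI simp: transpose_def)
  moreover have "map (swap_lists as bs) as = bs" "map (swap_lists as bs) bs = as"
    using Cons by auto
  moreover have "map (\<lambda>y. transpose a b (swap_lists as bs y)) cs = map (transpose a b) (map (swap_lists as bs) cs)" for cs
    by simp
  ultimately show ?case by (simp add: swap_lists_Cons o_def del: map_map)
qed

lemma swap_lists_involution: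
  assumes "length as = length bs" "distinct (as @ bs)"
  shows "swap_lists as bs (swap_lists as bs y) = y"
proof -
  let ?p = "swap_lists as bs"
  have m: "map ?p as = bs" "map ?p bs = as" using swap_lists_map[OF assms] by auto
  have "map (\<lambda>y. ?p (?p y)) as = map ?p (map ?p as)" by simp
  then have a: "map (\<lambda>y. ?p (?p y)) as = map (\<lambda>y. y) as" by (simp only: m list.map_ident)
  have "map (\<lambda>y. ?p (?p y)) bs = map ?p (map ?p bs)" by simp
  then have b: "map (\<lambda>y. ?p (?p y)) bs = map (\<lambda>y. y) bs" by (simp only: m list.map_ident)
  show ?thesis
    using a[unfolded map_eq_conv] b[unfolded map_eq_conv] swap_lists_outside[of y as bs] by fastforce
qed

lemma evenperm_swap_lists:
  assumes "length as = length bs" "distinct (as @ bs)"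
  shows "evenperm (swap_lists as bs) \<longleftrightarrow> even (length as)"
proof -
  have "\<forall>(a, b) \<in> set (zip as bs). a \<noteq> b"
    using assms(2) by (auto dest: set_zip_leftD set_zip_rightD)
  then show ?thesis
    using assms(1) by (simp add: swap_lists_def evenperm_apply_transps_iff)
qed

context two_cycles
begin

text \<open>
  If the two cycles have equal length, then \<open>tau\<close> fixes \<open>x\<close> and conjugates each cycle to the other.
\<close>

definition tau :: "nat \<Rightarrow> nat" where "tau = swap_lists as bs"

lemma tau_tau:
  assumes "length as = length bs"
  shows "tau \<circ> tau = id" "inv' tau = tau" "bij tau"
proof -
  show tt: "tau \<circ> tau = id"
    using swap_lists_involution[OF assms] distinct by (simp add: tau_def fun_eq_iff)
  then show "inv' tau = tau" by (intro inv_unique_comp)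
  show "bij tau" using tt by (rule o_bij[OF tt])
qed

lemma tau_permutes:
  assumes "length as = length bs"
  shows "tau permutes {1..n}"
proof (rule bij_imp_permutes)
  have outside: "tau y = y" if "y \<notin> {1..n}" for y
    using that support_iff[of y] unfolding tau_def by (intro swap_lists_outside) auto
  then show "\<And>y. y \<notin> {1..n} \<Longrightarrow> tau y = y" .
  have invol: "tau (tau y) = y" for y using tau_tau(1)[OF assms] by (metis comp_apply id_apply)
  then show "bij_betw tau {1..n} {1..n}"
    using outside by (intro bij_betw_byWitness[of _ tau]) (auto, metis+)
qed

lemma tau_conj:
  assumes "length as = length bs"
  shows "tau \<circ> alpha \<circ> tau = beta" "tau \<circ> beta \<circ> tau = alpha"
proof -
  have m: "map tau as = bs" using swap_lists_map[OF assms] distinct by (simp add: tau_def)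
  have x: "tau x = x" unfolding tau_def using distinct by (intro swap_lists_outside) auto
  have "tau \<circ> alpha \<circ> inv' tau = beta"
    using conjugation_of_cycle[of "x # as" tau] distinct tau_tau(3)[OF assms] m x
    by (simp add: alpha_def beta_def)
  then show conj: "tau \<circ> alpha \<circ> tau = beta" by (simp add: tau_tau(2)[OF assms])
  have "tau \<circ> beta \<circ> tau = (tau \<circ> tau) \<circ> alpha \<circ> (tau \<circ> tau)"
    unfolding conj[symmetric] by (simp only: comp_assoc)
  then show "tau \<circ> beta \<circ> tau = alpha" by (simp add: tau_tau(1)[OF assms])
qed

text \<open>
  The embedding that sends \<open>h\<close> to \<open>(h, tau h tau, 0)\<close> and the generator of \<open>\<int>/2\<close> to the element
  \<open>(tau, tau, 1)\<close>, an involution that commutes with all elements \<open>(h, tau h tau, 0)\<close>.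
\<close>

definition diagonal :: "(nat \<Rightarrow> nat) \<times> int \<Rightarrow> (nat \<Rightarrow> nat) \<times> (nat \<Rightarrow> nat) \<times> int" where
  "diagonal = (\<lambda>(h, g). if g = 0 then (h, tau \<circ> h \<circ> tau, 0) else (h \<circ> tau, tau \<circ> h, 1))"

text \<open>
  The permutations whose diagonal image lies in the generated subgroup.
\<close>

definition diagonal_part :: "(nat \<Rightarrow> nat) set" where
  "diagonal_part = {h. (h, tau \<circ> h \<circ> tau, 0) \<in> wreath_gen}"

lemma tau_cancel:
  assumes "length as = length bs"
  shows "tau (tau y) = y"
  using tau_tau(1)[OF assms] by (metis comp_apply id_apply)

lemma perm_subgroup_diagonal_part:
  assumes len: "length as = length bs"
  shows "perm_subgroup n diagonal_part"
proof (rule perm_subgroup.intro)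
  interpret swap_subgroup n wreath_gen by (rule swap_subgroup_wreath_gen)
  interpret S: group "sym_group n" by (rule sym_group_is_group)
  show "subgroup diagonal_part (sym_group n)"
  proof (rule S.subgroupI)
    show "diagonal_part \<subseteq> carrier (sym_group n)"
      using permutes by (auto simp: diagonal_part_def sym_group_carrier)
    have "id \<in> diagonal_part" using one by (simp add: diagonal_part_def tau_tau[OF len])
    then show "diagonal_part \<noteq> {}" by blast
    show "inv\<^bsub>sym_group n\<^esub> p \<in> diagonal_part" if "p \<in> diagonal_part" for p
    proof -
      have p: "(p, tau \<circ> p \<circ> tau, 0) \<in> wreath_gen" using that by (simp add: diagonal_part_def)
      then have pp: "p permutes {1..n}" by (rule permutes)
      then have "inv' (tau \<circ> p \<circ> tau) = tau \<circ> inv' p \<circ> tau"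
        by (simp add: o_inv_distrib permutes_bij tau_tau[OF len] bij_comp comp_assoc)
      then show ?thesis
        using inverse[OF p] pp by (simp add: diagonal_part_def sym_group_carrier)
    qed
    show "p \<otimes>\<^bsub>sym_group n\<^esub> q \<in> diagonal_part" if "p \<in> diagonal_part" "q \<in> diagonal_part" for p q
    proof -
      have "(tau \<circ> p \<circ> tau) \<circ> (tau \<circ> q \<circ> tau) = tau \<circ> (p \<circ> q) \<circ> tau"
        by (simp add: fun_eq_iff tau_cancel[OF len])
      then show ?thesis
        using that mult[of p "tau \<circ> p \<circ> tau" q "tau \<circ> q \<circ> tau"]
        by (simp add: diagonal_part_def sym_group_mult)
    qed
  qed
qed

lemma gens_diagonal_part:
  assumes len: "length as = length bs"
  shows "alpha \<in> diagonal_part" "beta \<in> diagonal_part"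
proof -
  interpret swap_subgroup n wreath_gen by (rule swap_subgroup_wreath_gen)
  show "alpha \<in> diagonal_part" "beta \<in> diagonal_part"
    using generator flip[OF generator] by (simp_all add: diagonal_part_def tau_conj[OF len])
qed

lemma diagonal_hom:
  assumes len: "length as = length bs"
  shows "diagonal \<in> hom (sym_group n \<times>\<times> integer_mod_group 2) (wreath_Z2 (sym_group n))"
proof (rule homI)
  show "diagonal z \<in> carrier (wreath_Z2 (sym_group n))"
    if "z \<in> carrier (sym_group n \<times>\<times> integer_mod_group 2)" for z
    using that tau_permutes[OF len]
    by (cases z) (auto simp: diagonal_def wreath_Z2_carrier sym_group_carrier permutes_compose)
  show "diagonal (y \<otimes>\<^bsub>sym_group n \<times>\<times> integer_mod_group 2\<^esub> z) =
      diagonal y \<otimes>\<^bsub>wreath_Z2 (sym_group n)\<^esub> diagonal z"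
    if "y \<in> carrier (sym_group n \<times>\<times> integer_mod_group 2)"
      "z \<in> carrier (sym_group n \<times>\<times> integer_mod_group 2)" for y z
    using that
    by (cases y; cases z)
      (auto simp: diagonal_def wreath_Z2_mult sym_group_mult carrier_integer_mod_group_2
        mult_integer_mod_group fun_eq_iff tau_cancel[OF len])
qed

lemma diagonal_inj:
  assumes len: "length as = length bs"
  shows "inj_on diagonal (UNIV \<times> {0, 1})"
proof (rule inj_onI, clarify)
  fix h k :: "nat \<Rightarrow> nat" and g g' :: int
  assume eq: "diagonal (h, g) = diagonal (k, g')" and g: "g \<in> {0, 1}" "g' \<in> {0, 1}"
  have "h = k" if "h \<circ> tau = k \<circ> tau"
  proof -
    have "h \<circ> (tau \<circ> tau) = k \<circ> (tau \<circ> tau)" using that by (simp only: comp_assoc[symmetric])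
    then show ?thesis by (simp add: tau_tau[OF len])
  qed
  then show "h = k \<and> g = g'" using eq g by (auto simp: diagonal_def split: if_splits)
qed

text \<open>
  The swap is \<open>(tau, tau, 0)\<close> times the central involution \<open>(tau, tau, 1)\<close>; therefore the image of
  \<open>C \<times> \<int>/2\<close> contains it as soon as \<open>C\<close> contains \<open>tau\<close>.
\<close>

lemma diagonal_iso:
  assumes len: "length as = length bs" and C: "subgroup C (sym_group n)"
    and gens: "alpha \<in> C" "tau \<in> C" and part: "C \<subseteq> diagonal_part"
  shows "subgroup_generated (wreath_Z2 (sym_group n)) wreath_gens \<cong>
    (sym_group n)\<lparr>carrier := C\<rparr> \<times>\<times> integer_mod_group 2"
proof -
  let ?S = "sym_group n" and ?W = "wreath_Z2 (sym_group n)"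
  let ?P = "?S\<lparr>carrier := C\<rparr> \<times>\<times> integer_mod_group 2"
  interpret W: group ?W by (rule group_wreath_Z2[OF sym_group_is_group])
  interpret swap_subgroup n wreath_gen by (rule swap_subgroup_wreath_gen)
  have carrierP: "carrier ?P = C \<times> {0, 1}" by (simp add: carrier_integer_mod_group_2)
  have P: "group ?P"
    by (intro DirProd_group group.subgroup_imp_group[OF sym_group_is_group C] group_integer_mod_group)
  have hom: "diagonal \<in> hom ?P ?W"
    using diagonal_hom[OF len] subgroup.subset[OF C]
    by (simp add: hom_def Pi_def DirProd_def) blast
  interpret group_hom ?P ?W diagonal
    using P hom by (simp add: group_hom_def group_hom_axioms_def)
  have image: "diagonal ` carrier ?P = wreath_gen"
  proof
    show "wreath_gen \<subseteq> diagonal ` carrier ?P"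
    proof (rule wreath_gen_subset)
      show "subgroup (diagonal ` carrier ?P) ?W" by (rule img_is_subgroup)
      have "(alpha, beta, 0) = diagonal (alpha, 0)" by (simp add: diagonal_def tau_conj[OF len])
      moreover have "(id, id, 1) = diagonal (tau, 1)" by (simp add: diagonal_def tau_tau[OF len])
      ultimately show "wreath_gens \<subseteq> diagonal ` carrier ?P"
        unfolding wreath_gens_def carrierP using gens by blast
    qed
    show "diagonal ` carrier ?P \<subseteq> wreath_gen"
    proof (rule image_subsetI)
      fix z assume "z \<in> carrier ?P"
      then obtain h g where z: "z = (h, g)" "h \<in> C" "g \<in> {0, 1}" unfolding carrierP by blast
      have "h \<circ> tau \<in> C" using subgroup.m_closed[OF C z(2) gens(2)] by (simp add: sym_group_mult)
      then have "(h \<circ> tau, tau \<circ> (h \<circ> tau) \<circ> tau, 0) \<in> wreath_gen"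
        using part by (auto simp: diagonal_part_def)
      moreover have "tau \<circ> (h \<circ> tau) \<circ> tau = tau \<circ> h"
        by (simp add: fun_eq_iff tau_cancel[OF len])
      ultimately have "(h \<circ> tau, tau \<circ> h, 1) \<in> wreath_gen" by (simp add: with_swap_iff)
      moreover have "(h, tau \<circ> h \<circ> tau, 0) \<in> wreath_gen" using part z(2) by (auto simp: diagonal_part_def)
      ultimately show "diagonal z \<in> wreath_gen" by (simp add: z(1) diagonal_def)
    qed
  qed
  have "carrier ?P \<subseteq> UNIV \<times> {0, 1}" unfolding carrierP by blast
  then have "bij_betw diagonal (carrier ?P) wreath_gen"
    unfolding bij_betw_def using image inj_on_subset[OF diagonal_inj[OF len]] by blast
  moreover have carrier: "carrier (subgroup_generated ?W wreath_gens) = wreath_gen"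
    using wreath_gens_carrier by (simp add: carrier_subgroup_generated Int_absorb1)
  moreover have "diagonal \<in> hom ?P (subgroup_generated ?W wreath_gens)"
    using hom image unfolding hom_def carrier by auto
  ultimately have "?P \<cong> subgroup_generated ?W wreath_gens"
    by (auto simp: is_iso_def iso_def)
  then show ?thesis by (rule group.iso_sym[OF P])
qed

lemma alternating_diagonal_part:
  assumes len: "length as = length bs"
  shows "carrier (alt_group n) \<subseteq> diagonal_part"
  by (rule alternating_if_generators[OF perm_subgroup_diagonal_part[OF len] gens_diagonal_part[OF len]])

lemma wreath_gen_equal_odd:
  assumes len: "length as = length bs" and even: "even (length as)"
  shows "subgroup_generated (wreath_Z2 (sym_group n)) wreath_gens \<cong> alt_group n \<times>\<times> integer_mod_group 2"
proof -
  have "alpha \<in> carrier (alt_group n)" "tau \<in> carrier (alt_group n)"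
    using alpha_permutes tau_permutes[OF len] evenperm_alpha evenperm_swap_lists[OF len] distinct even
    by (simp_all add: alt_group_carrier tau_def)
  from diagonal_iso[OF len alt_group_is_subgroup this alternating_diagonal_part[OF len]]
  show ?thesis by (simp add: alt_group_def)
qed

lemma wreath_gen_equal_even:
  assumes len: "length as = length bs" and odd: "odd (length as)"
  shows "subgroup_generated (wreath_Z2 (sym_group n)) wreath_gens \<cong> sym_group n \<times>\<times> integer_mod_group 2"
proof -
  interpret N: perm_subgroup n diagonal_part by (rule perm_subgroup_diagonal_part[OF len])
  have perm: "permutation p" if "p permutes {1..n}" for p
    using that permutation_permutes by blast
  have "p \<in> diagonal_part" if p: "p permutes {1..n}" for p
  proof (cases "evenperm p")
    case True
    then show ?thesis using p alternating_diagonal_part[OF len] by (auto simp: alt_group_carrier)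
  next
    case False
    then have "inv' alpha \<circ> p \<in> carrier (alt_group n)"
      using p alpha_permutes evenperm_alpha odd
      by (auto simp: alt_group_carrier permutes_compose permutes_inv evenperm_comp
          evenperm_inv permutation_inverse perm)
    then have "alpha \<circ> (inv' alpha \<circ> p) \<in> diagonal_part"
      using subsetD[OF alternating_diagonal_part[OF len]]
      by (intro N.comp[OF gens_diagonal_part(1)[OF len]])
    then show ?thesis using alpha_permutes by (simp add: comp_assoc[symmetric] permutes_inv_o)
  qed
  then have sub: "carrier (sym_group n) \<subseteq> diagonal_part" by (auto simp: sym_group_carrier)
  interpret S: group "sym_group n" by (rule sym_group_is_group)
  have "alpha \<in> carrier (sym_group n)" "tau \<in> carrier (sym_group n)"
    using alpha_permutes tau_permutes[OF len] by (simp_all add: sym_group_carrier)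
  from diagonal_iso[OF len S.subgroup_self this sub] show ?thesis by simp
qed

end

section \<open>The wreath product as a permutation group on edges\<close>

lemma subgroup_generated_iso_image:
  assumes f: "group_hom G H f" and inj: "inj_on f (carrier G)" and S: "S \<subseteq> carrier G"
  shows "subgroup_generated G S \<cong> subgroup_generated H (f ` S)"
proof -
  interpret group_hom G H f by fact
  have cG: "carrier (subgroup_generated G S) = generate G S"
    using S by (simp add: carrier_subgroup_generated Int_absorb1)
  have fS: "f ` S \<subseteq> carrier H" using S by auto
  have cH: "carrier (subgroup_generated H (f ` S)) = f ` generate G S"
    using fS generate_img[OF S] by (simp add: carrier_subgroup_generated Int_absorb1)
  have sub: "generate G S \<subseteq> carrier G" by (rule G.generate_incl[OF S])
  have "f \<in> hom (subgroup_generated G S) (subgroup_generated H (f ` S))"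
    using sub by (auto simp: hom_def cG cH subset_iff)
  moreover have "bij_betw f (generate G S) (f ` generate G S)"
    using inj_on_subset[OF inj sub] by (simp add: bij_betw_def)
  ultimately show ?thesis unfolding is_iso_def iso_def cG cH by auto
qed

text \<open>
  The wreath product acts on two copies of \<open>{1..n}\<close>, the second one being shifted to \<open>{n + 1..2 * n}\<close>:
  the first component takes values in the first copy, the second component in the second copy, and
  \<open>g\<close> decides whether the copies are interchanged.
\<close>

definition edge_action :: "nat \<Rightarrow> (nat \<Rightarrow> nat) \<times> (nat \<Rightarrow> nat) \<times> int \<Rightarrow> nat \<Rightarrow> nat" where
  "edge_action n = (\<lambda>(a, b, g) i.
     if i \<in> {1..n} then (if g = 0 then a i else n + b i)
     else if i \<in> {n + 1..2 * n} then (if g = 0 then n + b (i - n) else a (i - n))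
     else i)"

lemma edge_action_simps:
  assumes "a permutes {1..n}" "b permutes {1..n}" "i \<in> {1..n}"
  shows "edge_action n (a, b, 0) i = a i" "edge_action n (a, b, 1) i = n + b i"
    "edge_action n (a, b, 0) (n + i) = n + b i" "edge_action n (a, b, 1) (n + i) = a i"
  using assms by (auto simp: edge_action_def)

lemma edge_action_outside: "i \<notin> {1..2 * n} \<Longrightarrow> edge_action n w i = i"
  by (cases w) (auto simp: edge_action_def)

lemma edge_action_mult:
  assumes "y \<in> carrier (wreath_Z2 (sym_group n))" "z \<in> carrier (wreath_Z2 (sym_group n))"
  shows "edge_action n (y \<otimes>\<^bsub>wreath_Z2 (sym_group n)\<^esub> z) = edge_action n y \<circ> edge_action n z"
proof
  fix i
  obtain a b g where y: "y = (a, b, g)" by (cases y)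
  obtain c d g' where z: "z = (c, d, g')" by (cases z)
  have p: "a permutes {1..n}" "b permutes {1..n}" "c permutes {1..n}" "d permutes {1..n}"
    and g: "g = 0 \<or> g = 1" "g' = 0 \<or> g' = 1"
    using assms by (auto simp: y z wreath_Z2_sym_carrier)
  have pc: "a \<circ> c permutes {1..n}" "b \<circ> d permutes {1..n}" "a \<circ> d permutes {1..n}" "b \<circ> c permutes {1..n}"
    using p by (simp_all add: permutes_compose)
  have im: "c j \<in> {1..n}" "d j \<in> {1..n}" if "j \<in> {1..n}" for j
    using that p by (simp_all only: permutes_in_image)
  consider (left) "i \<in> {1..n}" | (right) j where "i = n + j" "j \<in> {1..n}" | (out) "i \<notin> {1..2 * n}"
  proof -
    have "\<exists>j. i = n + j \<and> j \<in> {1..n}" if "i \<notin> {1..n}" "i \<in> {1..2 * n}"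
      using that by (intro exI[of _ "i - n"]) auto
    then show ?thesis using that by blast
  qed
  then show "edge_action n (y \<otimes>\<^bsub>wreath_Z2 (sym_group n)\<^esub> z) i = (edge_action n y \<circ> edge_action n z) i"
  proof cases
    case left
    with p pc im[OF left] g show ?thesis
      by (elim disjE) (simp_all add: y z wreath_Z2_mult sym_group_mult edge_action_simps del: atLeastAtMost_iff)
  next
    case (right j)
    with p pc im[OF right(2)] g show ?thesis
      by (elim disjE) (simp_all add: y z wreath_Z2_mult sym_group_mult edge_action_simps del: atLeastAtMost_iff)
  next
    case out
    show ?thesis unfolding o_apply edge_action_outside[OF out] ..
  qed
qed

lemma edge_action_permutes:
  assumes y: "y \<in> carrier (wreath_Z2 (sym_group n))"
  shows "edge_action n y permutes {1..2 * n}"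
proof (rule bij_imp_permutes)
  interpret W: group "wreath_Z2 (sym_group n)" by (rule group_wreath_Z2[OF sym_group_is_group])
  show "edge_action n y i = i" if "i \<notin> {1..2 * n}" for i
    using that by (rule edge_action_outside)
  have maps: "edge_action n z i \<in> {1..2 * n}"
    if "z \<in> carrier (wreath_Z2 (sym_group n))" "i \<in> {1..2 * n}" for z i
  proof -
    obtain a b g where z: "z = (a, b, g)" by (cases z)
    have "a permutes {1..n}" "b permutes {1..n}" using that by (auto simp: z wreath_Z2_sym_carrier)
    then have im: "a j \<in> {1..n}" "b j \<in> {1..n}" if "j \<in> {1..n}" for j
      using that by (simp_all only: permutes_in_image)
    show ?thesis
    proof (cases "i \<in> {1..n}")
      case True
      then show ?thesis using im[OF True] by (auto simp: z edge_action_def)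
    next
      case False
      then have j: "i - n \<in> {1..n}" using that(2) by auto
      then show ?thesis using im[OF j] that(2) False by (auto simp: z edge_action_def)
    qed
  qed
  have one: "edge_action n \<one>\<^bsub>wreath_Z2 (sym_group n)\<^esub> i = i" for i
    by (auto simp: wreath_Z2_one sym_group_one edge_action_def)
  let ?z = "inv\<^bsub>wreath_Z2 (sym_group n)\<^esub> y"
  have "edge_action n ?z (edge_action n y i) = i" "edge_action n y (edge_action n ?z i) = i" for i
    using edge_action_mult[OF W.inv_closed[OF y] y] edge_action_mult[OF y W.inv_closed[OF y]] one[of i]
    by (simp_all add: W.l_inv[OF y] W.r_inv[OF y] fun_eq_iff)
  then show "bij_betw (edge_action n y) {1..2 * n} {1..2 * n}"
    using maps[OF y] maps[OF W.inv_closed[OF y]]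
    by (intro bij_betw_byWitness[of _ "edge_action n ?z"]) blast+
qed

lemma edge_action_inj:
  assumes "n \<ge> 1"
  shows "inj_on (edge_action n) (carrier (wreath_Z2 (sym_group n)))"
proof (rule inj_onI)
  fix y z assume yz: "y \<in> carrier (wreath_Z2 (sym_group n))" "z \<in> carrier (wreath_Z2 (sym_group n))"
    and eq: "edge_action n y = edge_action n z"
  obtain a b g where y: "y = (a, b, g)" by (cases y)
  obtain c d g' where z: "z = (c, d, g')" by (cases z)
  have p: "a permutes {1..n}" "b permutes {1..n}" "c permutes {1..n}" "d permutes {1..n}"
    and g: "g = 0 \<or> g = 1" "g' = 0 \<or> g' = 1"
    using yz by (auto simp: y z wreath_Z2_sym_carrier)
  have im: "a j \<in> {1..n}" "b j \<in> {1..n}" "c j \<in> {1..n}" "d j \<in> {1..n}" if "j \<in> {1..n}" for j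
    using that p by (simp_all only: permutes_in_image)
  note eqs = fun_cong[OF eq, unfolded y z]
  have "g = g'"
    using eqs[of 1] edge_action_simps(1,2)[OF p(1,2), of 1] edge_action_simps(1,2)[OF p(3,4), of 1]
      im[of 1] g assms by auto
  moreover have "a j = c j \<and> b j = d j" for j
  proof (cases "j \<in> {1..n}")
    case True
    show ?thesis
      using eqs[of j] eqs[of "n + j"] edge_action_simps[OF p(1,2) True] edge_action_simps[OF p(3,4) True] g
        \<open>g = g'\<close> by auto
  next
    case False
    then show ?thesis using p by (simp add: permutes_not_in)
  qed
  ultimately show "y = z" by (auto simp: y z)
qed

lemma edge_action_conj_iso:
  assumes pi: "p permutes {1..2 * n}" and n: "n \<ge> 1"
    and S: "S \<subseteq> carrier (wreath_Z2 (sym_group n))"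
  shows "subgroup_generated (sym_group (2 * n)) ((\<lambda>w. p \<circ> edge_action n w \<circ> inv' p) ` S) \<cong>
    subgroup_generated (wreath_Z2 (sym_group n)) S"
proof -
  let ?W = "wreath_Z2 (sym_group n)" and ?f = "\<lambda>w. p \<circ> edge_action n w \<circ> inv' p"
  interpret W: group ?W by (rule group_wreath_Z2[OF sym_group_is_group])
  have cancel: "inv' p (p i) = i" "p (inv' p i) = i" for i using permutes_inverses[OF pi] by auto
  have "?f \<in> hom ?W (sym_group (2 * n))"
  proof (rule homI)
    show "?f y \<in> carrier (sym_group (2 * n))" if "y \<in> carrier ?W" for y
      using pi edge_action_permutes[OF that]
      by (simp add: sym_group_carrier permutes_compose permutes_inv)
    show "?f (y \<otimes>\<^bsub>?W\<^esub> z) = ?f y \<otimes>\<^bsub>sym_group (2 * n)\<^esub> ?f z" if "y \<in> carrier ?W" "z \<in> carrier ?W" for y z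
      unfolding edge_action_mult[OF that] by (simp add: sym_group_mult fun_eq_iff cancel)
  qed
  then have hom: "group_hom ?W (sym_group (2 * n)) ?f"
    using W.is_group sym_group_is_group by (simp add: group_hom_def group_hom_axioms_def)
  have "inj_on ?f (carrier ?W)"
  proof (rule inj_onI)
    fix y z assume yz: "y \<in> carrier ?W" "z \<in> carrier ?W" and eq: "?f y = ?f z"
    have "edge_action n y i = edge_action n z i" for i
      using arg_cong[OF fun_cong[OF eq, of "p i"], of "inv' p"] by (simp add: cancel)
    then have "edge_action n y = edge_action n z" by blast
    then show "y = z" by (rule inj_onD[OF edge_action_inj[OF n] _ yz])
  qed
  from subgroup_generated_iso_image[OF hom this S]
  show ?thesis by (rule group.iso_sym[OF W.group_subgroup_generated])
qed

section \<open>Rotations of a dessin\<close>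

lemma cyclic_on_period:
  assumes cyc: "cyclic_on f S" and s: "s \<in> S"
  shows "(f ^^ card S) s = s" and "0 < k \<Longrightarrow> k < card S \<Longrightarrow> (f ^^ k) s \<noteq> s"
    and "y \<in> S \<Longrightarrow> \<exists>k. y = (f ^^ k) s"
proof -
  have S: "S = orbit f s" using cyc s by (simp add: cyclic_on_alldef)
  then have so: "s \<in> orbit f s" using s by simp
  let ?d = "funpow_dist1 f s s"
  have "card S = ?d"
    unfolding S orbit_conv_funpow_dist1[OF so] by (subst card_image[OF inj_on_funpow_dist1[OF so]]) simp
  then show "(f ^^ card S) s = s" "0 < k \<Longrightarrow> k < card S \<Longrightarrow> (f ^^ k) s \<noteq> s"
    using funpow_dist1_prop[OF so] funpow_dist1_least[of k f s s] by simp_all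
  show "\<exists>k. y = (f ^^ k) s" if "y \<in> S"
    using that S orbit_altdef_self_in[OF so] by auto
qed

text \<open>
  The edge that follows \<open>e\<close> around its black end, and the edge that follows it around its white end.
  Up to the labelling these are the two generators of the monodromy group.
\<close>

definition bnext :: "('v, 'e) dessin \<Rightarrow> 'e \<Rightarrow> 'e" where
  "bnext D e = rot D (bend D e) e"

definition wnext :: "('v, 'e) dessin \<Rightarrow> 'e \<Rightarrow> 'e" where
  "wnext D e = rot D (wend D e) e"

locale dessin =
  fixes D :: "('v, 'e) dessin"
  assumes dessin: "is_dessin D"
begin

lemma bend_black: "e \<in> edges D \<Longrightarrow> bend D e \<in> black D"
  and wend_white: "e \<in> edges D \<Longrightarrow> wend D e \<in> white D"
  and disjoint: "black D \<inter> white D = {}"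
  and finite_edges: "finite (edges D)"
  and finite_black: "finite (black D)"
  and finite_white: "finite (white D)"
  and connected: "connected_dessin D"
  using dessin by (auto simp: is_dessin_def vertices_def)

lemma bend_vertex: "e \<in> edges D \<Longrightarrow> bend D e \<in> vertices D"
  and wend_vertex: "e \<in> edges D \<Longrightarrow> wend D e \<in> vertices D"
  using bend_black wend_white by (auto simp: vertices_def)

lemma star_black: "v \<in> black D \<Longrightarrow> star D v = {e \<in> edges D. bend D e = v}"
  and star_white: "v \<in> white D \<Longrightarrow> star D v = {e \<in> edges D. wend D e = v}"
  using bend_black wend_white disjoint by (auto simp: star_def ends_def)

lemma bend_image:
  assumes "\<And>v. v \<in> vertices D \<Longrightarrow> star D v \<noteq> {}"
  shows "bend D ` edges D = black D"
proof
  show "bend D ` edges D \<subseteq> black D" using bend_black by blast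
  show "black D \<subseteq> bend D ` edges D"
  proof
    fix v assume v: "v \<in> black D"
    then have "star D v \<noteq> {}" by (intro assms) (simp add: vertices_def)
    then show "v \<in> bend D ` edges D" unfolding star_black[OF v] by blast
  qed
qed

lemma wend_image:
  assumes "\<And>v. v \<in> vertices D \<Longrightarrow> star D v \<noteq> {}"
  shows "wend D ` edges D = white D"
proof
  show "wend D ` edges D \<subseteq> white D" using wend_white by blast
  show "white D \<subseteq> wend D ` edges D"
  proof
    fix v assume v: "v \<in> white D"
    then have "star D v \<noteq> {}" by (intro assms) (simp add: vertices_def)
    then show "v \<in> wend D ` edges D" unfolding star_white[OF v] by blast
  qed
qed

lemma cyclic_star:
  assumes "e \<in> star D v" "v \<in> vertices D"
  shows "cyclic_on (rot D v) (star D v)"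
  using dessin assms unfolding is_dessin_def by blast

lemma in_star_bend: "e \<in> edges D \<Longrightarrow> e \<in> star D (bend D e)"
  and in_star_wend: "e \<in> edges D \<Longrightarrow> e \<in> star D (wend D e)"
  by (simp_all add: star_def ends_def)

lemma bnext_star:
  assumes e: "e \<in> edges D"
  shows "bnext D e \<in> edges D" "bend D (bnext D e) = bend D e"
proof -
  have "bnext D e \<in> star D (bend D e)"
    unfolding bnext_def
    by (rule cyclic_on_inI[OF cyclic_star[OF in_star_bend[OF e] bend_vertex[OF e]] in_star_bend[OF e]])
  then show "bnext D e \<in> edges D" "bend D (bnext D e) = bend D e"
    by (simp_all add: star_black[OF bend_black[OF e]])
qed

lemma wnext_star:
  assumes e: "e \<in> edges D"
  shows "wnext D e \<in> edges D" "wend D (wnext D e) = wend D e"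
proof -
  have "wnext D e \<in> star D (wend D e)"
    unfolding wnext_def
    by (rule cyclic_on_inI[OF cyclic_star[OF in_star_wend[OF e] wend_vertex[OF e]] in_star_wend[OF e]])
  then show "wnext D e \<in> edges D" "wend D (wnext D e) = wend D e"
    by (simp_all add: star_white[OF wend_white[OF e]])
qed

lemma bnext_funpow:
  assumes e: "e \<in> edges D"
  shows "(bnext D ^^ k) e \<in> edges D" "bend D ((bnext D ^^ k) e) = bend D e"
    "(bnext D ^^ k) e = (rot D (bend D e) ^^ k) e"
proof -
  have all: "(bnext D ^^ k) e \<in> edges D \<and> bend D ((bnext D ^^ k) e) = bend D e \<and>
    (bnext D ^^ k) e = (rot D (bend D e) ^^ k) e"
  proof (induction k)
    case (Suc k)
    let ?d = "(bnext D ^^ k) e"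
    have d: "?d \<in> edges D" "bend D ?d = bend D e" using Suc by auto
    have eq: "?d = (rot D (bend D e) ^^ k) e" using Suc by blast
    have "bnext D ?d = rot D (bend D e) ?d" by (simp only: bnext_def d(2))
    from trans[OF this arg_cong[OF eq, of "rot D (bend D e)"]]
    show ?case using bnext_star[OF d(1)] d(2) by simp
  qed (use e in simp)
  then show "(bnext D ^^ k) e \<in> edges D" "bend D ((bnext D ^^ k) e) = bend D e"
    "(bnext D ^^ k) e = (rot D (bend D e) ^^ k) e" by blast+
qed

lemma wnext_funpow:
  assumes e: "e \<in> edges D"
  shows "(wnext D ^^ k) e \<in> edges D" "wend D ((wnext D ^^ k) e) = wend D e"
    "(wnext D ^^ k) e = (rot D (wend D e) ^^ k) e"
proof -
  have all: "(wnext D ^^ k) e \<in> edges D \<and> wend D ((wnext D ^^ k) e) = wend D e \<and>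
    (wnext D ^^ k) e = (rot D (wend D e) ^^ k) e"
  proof (induction k)
    case (Suc k)
    let ?d = "(wnext D ^^ k) e"
    have d: "?d \<in> edges D" "wend D ?d = wend D e" using Suc by auto
    have eq: "?d = (rot D (wend D e) ^^ k) e" using Suc by blast
    have "wnext D ?d = rot D (wend D e) ?d" by (simp only: wnext_def d(2))
    from trans[OF this arg_cong[OF eq, of "rot D (wend D e)"]]
    show ?case using wnext_star[OF d(1)] d(2) by simp
  qed (use e in simp)
  then show "(wnext D ^^ k) e \<in> edges D" "wend D ((wnext D ^^ k) e) = wend D e"
    "(wnext D ^^ k) e = (rot D (wend D e) ^^ k) e" by blast+
qed

lemma same_bend_iff:
  assumes e: "e \<in> edges D" "e' \<in> edges D"
  shows "bend D e = bend D e' \<longleftrightarrow> (\<exists>k. e' = (bnext D ^^ k) e)"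
proof
  assume "bend D e = bend D e'"
  then have "e' \<in> star D (bend D e)" using in_star_bend[OF e(2)] by simp
  then obtain k where "e' = (rot D (bend D e) ^^ k) e"
    using cyclic_on_period(3)[OF cyclic_star[OF in_star_bend[OF e(1)] bend_vertex[OF e(1)]] in_star_bend[OF e(1)]]
    by blast
  then have "e' = (bnext D ^^ k) e" using bnext_funpow(3)[OF e(1), of k] by simp
  then show "\<exists>k. e' = (bnext D ^^ k) e" by blast
next
  assume "\<exists>k. e' = (bnext D ^^ k) e"
  then obtain k where "e' = (bnext D ^^ k) e" by blast
  then show "bend D e = bend D e'" using bnext_funpow(2)[OF e(1), of k] by simp
qed

lemma same_wend_iff:
  assumes e: "e \<in> edges D" "e' \<in> edges D"
  shows "wend D e = wend D e' \<longleftrightarrow> (\<exists>k. e' = (wnext D ^^ k) e)"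
proof
  assume "wend D e = wend D e'"
  then have "e' \<in> star D (wend D e)" using in_star_wend[OF e(2)] by simp
  then obtain k where "e' = (rot D (wend D e) ^^ k) e"
    using cyclic_on_period(3)[OF cyclic_star[OF in_star_wend[OF e(1)] wend_vertex[OF e(1)]] in_star_wend[OF e(1)]]
    by blast
  then have "e' = (wnext D ^^ k) e" using wnext_funpow(3)[OF e(1), of k] by simp
  then show "\<exists>k. e' = (wnext D ^^ k) e" by blast
next
  assume "\<exists>k. e' = (wnext D ^^ k) e"
  then obtain k where "e' = (wnext D ^^ k) e" by blast
  then show "wend D e = wend D e'" using wnext_funpow(2)[OF e(1), of k] by simp
qed

lemma bnext_period:
  assumes e: "e \<in> edges D"
  shows "(bnext D ^^ degree D (bend D e)) e = e"
    and "0 < k \<Longrightarrow> k < degree D (bend D e) \<Longrightarrow> (bnext D ^^ k) e \<noteq> e"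
  using cyclic_on_period(1,2)[OF cyclic_star[OF in_star_bend[OF e] bend_vertex[OF e]] in_star_bend[OF e]]
    bnext_funpow(3)[OF e] by (simp_all add: degree_def)

lemma wnext_period:
  assumes e: "e \<in> edges D"
  shows "(wnext D ^^ degree D (wend D e)) e = e"
    and "0 < k \<Longrightarrow> k < degree D (wend D e) \<Longrightarrow> (wnext D ^^ k) e \<noteq> e"
  using cyclic_on_period(1,2)[OF cyclic_star[OF in_star_wend[OF e] wend_vertex[OF e]] in_star_wend[OF e]]
    wnext_funpow(3)[OF e] by (simp_all add: degree_def)

text \<open>
  Connectedness in terms of edges: the two rotations generate a transitive group.
\<close>

lemma transitive:
  assumes S: "S \<subseteq> edges D" "S \<noteq> {}"
    and closed: "\<And>e. e \<in> S \<Longrightarrow> bnext D e \<in> S" "\<And>e. e \<in> S \<Longrightarrow> wnext D e \<in> S"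
  shows "S = edges D"
proof
  show "S \<subseteq> edges D" by (rule S)
  have bclosed: "e' \<in> S" if d: "e \<in> S" "e' \<in> edges D" "bend D e = bend D e'" for e e'
  proof -
    obtain k where k: "e' = (bnext D ^^ k) e" using same_bend_iff[of e e'] d S by blast
    have "(bnext D ^^ k) e \<in> S" by (induction k) (simp_all add: closed d)
    then show ?thesis by (simp add: k)
  qed
  have wclosed: "e' \<in> S" if d: "e \<in> S" "e' \<in> edges D" "wend D e = wend D e'" for e e'
  proof -
    obtain k where k: "e' = (wnext D ^^ k) e" using same_wend_iff[of e e'] d S by blast
    have "(wnext D ^^ k) e \<in> S" by (induction k) (simp_all add: closed d)
    then show ?thesis by (simp add: k)
  qed
  have touch: "e' \<in> S" if "e \<in> S" "e' \<in> edges D" "ends D e \<inter> ends D e' \<noteq> {}" for e e'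
  proof -
    have e: "e \<in> edges D" using that(1) S(1) by blast
    have "bend D e \<noteq> wend D e'" "wend D e \<noteq> bend D e'"
      using bend_black[OF e] wend_white[OF e] bend_black[OF that(2)] wend_white[OF that(2)] disjoint by auto
    then have "bend D e = bend D e' \<or> wend D e = wend D e'" using that(3) by (auto simp: ends_def)
    then show ?thesis using bclosed[OF that(1,2)] wclosed[OF that(1,2)] by blast
  qed
  obtain e0 where e0: "e0 \<in> S" using S by blast
  show "edges D \<subseteq> S"
  proof
    fix e assume e: "e \<in> edges D"
    obtain vs es where w: "walk D vs es" "hd vs = bend D e0" "last vs = bend D e"
      using connected bend_vertex[OF e] bend_vertex[of e0] e0 S unfolding connected_dessin_def by blast
    have len: "length vs = Suc (length es)" "set es \<subseteq> edges D"
      "\<And>i. i < length es \<Longrightarrow> ends D (es ! i) = {vs ! i, vs ! Suc i}"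
      using w(1) by (auto simp: walk_def)
    have reach: "\<exists>f \<in> S. vs ! i \<in> ends D f" if "i \<le> length es" for i
      using that
    proof (induction i)
      case 0
      have "vs ! 0 = bend D e0" using w(2) len(1) by (cases vs) auto
      then show ?case using e0 by (auto simp: ends_def)
    next
      case (Suc i)
      then obtain f where f: "f \<in> S" "vs ! i \<in> ends D f" by auto
      have i: "i < length es" using Suc.prems by simp
      have "es ! i \<in> S" using touch[OF f(1), of "es ! i"] f(2) len(2) len(3)[OF i] nth_mem[OF i] by blast
      moreover have "vs ! Suc i \<in> ends D (es ! i)" using len(3)[OF i] by simp
      ultimately show ?case by blast
    qed
    have "vs ! length es = bend D e" using w(3) len(1) by (cases vs rule: rev_cases) (auto simp: nth_append)
    with reach[of "length es"] obtain f where "f \<in> S" "bend D e \<in> ends D f" by auto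
    then show "e \<in> S" using touch[of f e] e by (auto simp: ends_def)
  qed
qed

end

text \<open>
  Vertices of one colour are the orbits of the rotation \<open>f\<close> around them. So a bijection of edges that
  commutes with the rotations induces a bijection of vertices.
\<close>

lemma induced_vertex_bij:
  assumes psi: "bij_betw \<psi> E E'" and b: "b ` E = V" "b' ` E' = V'"
    and f: "\<And>e. e \<in> E \<Longrightarrow> f e \<in> E" "\<And>e. e \<in> E \<Longrightarrow> \<psi> (f e) = f' (\<psi> e)"
    and orb: "\<And>e d. e \<in> E \<Longrightarrow> d \<in> E \<Longrightarrow> b e = b d \<longleftrightarrow> (\<exists>k. d = (f ^^ k) e)"
    and orb': "\<And>e d. e \<in> E' \<Longrightarrow> d \<in> E' \<Longrightarrow> b' e = b' d \<longleftrightarrow> (\<exists>k. d = (f' ^^ k) e)"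
  obtains \<phi> where "bij_betw \<phi> V V'" "\<And>e. e \<in> E \<Longrightarrow> \<phi> (b e) = b' (\<psi> e)"
proof -
  have fk: "(f ^^ k) e \<in> E \<and> \<psi> ((f ^^ k) e) = (f' ^^ k) (\<psi> e)" if "e \<in> E" for e k
    using that by (induction k) (auto simp: f)
  have psiE: "\<psi> e \<in> E'" if "e \<in> E" for e using psi that by (auto simp: bij_betw_def)
  have key: "b e = b d \<longleftrightarrow> b' (\<psi> e) = b' (\<psi> d)" if ed: "e \<in> E" "d \<in> E" for e d
  proof -
    have "d = (f ^^ k) e \<longleftrightarrow> \<psi> d = (f' ^^ k) (\<psi> e)" for k
      using fk[OF ed(1), of k] psi ed by (auto simp: bij_betw_def inj_on_def)
    then show ?thesis using orb[OF ed] orb'[OF psiE[OF ed(1)] psiE[OF ed(2)]] by simp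
  qed
  define \<phi> where "\<phi> v = b' (\<psi> (SOME e. e \<in> E \<and> b e = v))" for v
  have phi: "\<phi> (b e) = b' (\<psi> e)" if "e \<in> E" for e
  proof -
    have "(SOME d. d \<in> E \<and> b d = b e) \<in> E \<and> b (SOME d. d \<in> E \<and> b d = b e) = b e"
      by (rule someI_ex) (use that in blast)
    then show ?thesis unfolding \<phi>_def using key[of "SOME d. d \<in> E \<and> b d = b e" e] that by blast
  qed
  have "\<phi> ` V = V'"
  proof -
    have "\<phi> ` V = (\<lambda>e. b' (\<psi> e)) ` E" unfolding b(1)[symmetric] image_image using phi by (intro image_cong) simp_all
    also have "\<dots> = b' ` (\<psi> ` E)" by (simp only: image_image)
    also have "\<dots> = V'" using psi b(2) by (simp add: bij_betw_def)
    finally show ?thesis .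
  qed
  moreover have "inj_on \<phi> V"
  proof (rule inj_onI)
    fix u v assume uv: "u \<in> V" "v \<in> V" "\<phi> u = \<phi> v"
    then obtain e d where "e \<in> E" "d \<in> E" "u = b e" "v = b d" unfolding b(1)[symmetric] by blast
    then show "u = v" using uv(3) phi key by simp
  qed
  ultimately show ?thesis using phi that[of \<phi>] by (simp add: bij_betw_def)
qed

lemma dessin_iso_if_intertwined:
  assumes "is_dessin D" "is_dessin D'"
    and noniso: "\<And>v. v \<in> vertices D \<Longrightarrow> star D v \<noteq> {}" "\<And>v. v \<in> vertices D' \<Longrightarrow> star D' v \<noteq> {}"
    and psi: "bij_betw \<psi> (edges D) (edges D')"
    and bnext: "\<And>e. e \<in> edges D \<Longrightarrow> \<psi> (bnext D e) = bnext D' (\<psi> e)"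
    and wnext: "\<And>e. e \<in> edges D \<Longrightarrow> \<psi> (wnext D e) = wnext D' (\<psi> e)"
  shows "dessin_iso D D'"
proof -
  interpret D: dessin D by (rule dessin.intro) fact
  interpret D': dessin D' by (rule dessin.intro) fact
  have ims: "bend D ` edges D = black D" "wend D ` edges D = white D"
    "bend D' ` edges D' = black D'" "wend D' ` edges D' = white D'"
    using noniso by (simp_all add: D.bend_image D.wend_image D'.bend_image D'.wend_image)
  obtain \<phi>b where b: "bij_betw \<phi>b (black D) (black D')"
    "\<And>e. e \<in> edges D \<Longrightarrow> \<phi>b (bend D e) = bend D' (\<psi> e)"
    by (rule induced_vertex_bij[OF psi ims(1,3) D.bnext_star(1) bnext D.same_bend_iff D'.same_bend_iff]) auto
  obtain \<phi>w where w: "bij_betw \<phi>w (white D) (white D')"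
    "\<And>e. e \<in> edges D \<Longrightarrow> \<phi>w (wend D e) = wend D' (\<psi> e)"
    by (rule induced_vertex_bij[OF psi ims(2,4) D.wnext_star(1) wnext D.same_wend_iff D'.same_wend_iff]) auto
  define \<phi> where "\<phi> v = (if v \<in> black D then \<phi>b v else \<phi>w v)" for v
  have notb: "v \<notin> black D" if "v \<in> white D" for v using that D.disjoint by blast
  have "bij_betw \<phi> (black D) (black D')"
    using b(1) by (rule bij_betw_cong[THEN iffD1, rotated]) (simp add: \<phi>_def)
  moreover have "bij_betw \<phi> (white D) (white D')"
    using w(1) by (rule bij_betw_cong[THEN iffD1, rotated]) (simp add: \<phi>_def notb)
  ultimately have bij: "bij_betw \<phi> (vertices D) (vertices D')" and
    im: "\<phi> ` black D = black D'" "\<phi> ` white D = white D'"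
    unfolding vertices_def using bij_betw_combine[OF _ _ D'.disjoint] by (auto simp: bij_betw_def)
  have ends: "bend D' (\<psi> e) = \<phi> (bend D e)" "wend D' (\<psi> e) = \<phi> (wend D e)" if "e \<in> edges D" for e
    using b(2)[OF that] w(2)[OF that] D.bend_black[OF that] notb[OF D.wend_white[OF that]]
    by (simp_all add: \<phi>_def)
  have "rot D' (\<phi> v) (\<psi> e) = \<psi> (rot D v e)" if v: "v \<in> vertices D" and e: "e \<in> star D v" for v e
  proof -
    have eE: "e \<in> edges D" and "v = bend D e \<or> v = wend D e" using e by (auto simp: star_def ends_def)
    then show ?thesis using bnext[OF eE] wnext[OF eE] ends[OF eE] by (auto simp: bnext_def wnext_def)
  qed
  then show ?thesis unfolding dessin_iso_def using bij im psi ends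
    by (intro exI[of _ \<phi>] exI[of _ \<psi>]) auto
qed

section \<open>Trees with two branching black vertices\<close>

text \<open>
  The integer interval \<open>{i..j}\<close> as an increasing list. A separate constant protects the two cycles
  below from being unfolded together with their lists.
\<close>

definition segment :: "nat \<Rightarrow> nat \<Rightarrow> nat list" where
  "segment i j = [i..<Suc j]"

text \<open>
  The two branching vertices have degrees \<open>r\<close> and \<open>t\<close>, and there are \<open>m\<close> white vertices. The rotation
  \<open>alpha\<close> is the cycle \<open>(1, 2, \<dots>, r)\<close> and \<open>beta\<close> is the cycle \<open>(1, r + 1, \<dots>, m)\<close>.
\<close>

locale star_sizes =
  fixes r t m :: nat
  assumes sizes: "r > 1" "t > 1" and m: "m = r + t - 1"
begin

lemma first_cycle: "Suc 0 # segment 2 r = [Suc 0..<Suc r]"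
  using upt_conv_Cons[of "Suc 0" "Suc r"] sizes by (simp add: segment_def numeral_2_eq_2 del: upt_Suc)

lemma all_points: "Suc 0 # segment 2 r @ segment (Suc r) m = [Suc 0..<Suc m]"
proof -
  have "Suc 0 # segment 2 r @ segment (Suc r) m = [Suc 0..<Suc r] @ [Suc r..<Suc m]"
    using first_cycle by (simp add: segment_def del: upt_Suc)
  then show ?thesis using upt_add_eq_append[of "Suc 0" "Suc r" "m - r"] sizes m by (simp del: upt_Suc)
qed

sublocale two_cycles m "Suc 0" "segment 2 r" "segment (Suc r) m"
proof
  show "distinct (Suc 0 # segment 2 r @ segment (Suc r) m)"
    "set (Suc 0 # segment 2 r @ segment (Suc r) m) = {1..m}"
    unfolding all_points by auto
  show "segment 2 r \<noteq> []" "segment (Suc r) m \<noteq> []" using sizes m by (auto simp: segment_def)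
qed

lemma alpha_apply:
  "alpha i = (if i \<in> {1..<r} then Suc i else if i = r then 1 else i)"
proof (cases "i \<in> {1..r}")
  case True
  have "alpha ([Suc 0..<Suc r] ! (i - 1)) = [Suc 0..<Suc r] ! (Suc (i - 1) mod r)"
    unfolding alpha_def first_cycle using cycle_of_list_nth[of "[Suc 0..<Suc r]" "i - 1"] True
    by (auto simp del: upt_Suc)
  then show ?thesis using True sizes by (cases "i = r") (auto simp del: upt_Suc)
next
  case False
  then have "i \<notin> set (Suc 0 # segment 2 r)" unfolding first_cycle by auto
  then have "alpha i = i" unfolding alpha_def by (rule id_outside_supp)
  then show ?thesis using False sizes by auto
qed

lemma beta_apply:
  "beta i = (if i = 1 then Suc r else if i \<in> {Suc r..<m} then Suc i else if i = m then 1 else i)"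
proof (cases "i = 1 \<or> i \<in> {Suc r..m}")
  case True
  let ?cs = "Suc 0 # segment (Suc r) m"
  have cs: "distinct ?cs" "length ?cs = t" using sizes m by (auto simp: segment_def)
  define j where "j = (if i = 1 then 0 else i - r)"
  have j: "j < t" using True sizes m by (auto simp: j_def)
  have nth: "?cs ! k = (if k = 0 then 1 else r + k)" if "k < t" for k
    using that m by (cases k) (auto simp: segment_def simp del: upt_Suc)
  have "i = ?cs ! j" unfolding nth[OF j] using True by (auto simp: j_def)
  then have "beta i = ?cs ! (Suc j mod t)"
    unfolding beta_def using cycle_of_list_nth[OF cs(1), of j] j cs(2) by simp
  also have "\<dots> = (if Suc j mod t = 0 then 1 else r + Suc j mod t)" using sizes by (intro nth) simp
  finally show ?thesis using True sizes m j by (cases "Suc j = t") (auto simp: j_def)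
next
  case False
  then have "i \<notin> set (Suc 0 # segment (Suc r) m)" by (auto simp: segment_def)
  then have "beta i = i" unfolding beta_def by (rule id_outside_supp)
  then show ?thesis using False sizes m by auto
qed

text \<open>
  The rotations of the model tree on the edges \<open>1, \<dots>, 2 * m\<close>. For \<open>i \<le> m\<close> the edges \<open>i\<close>
  and \<open>m + i\<close> share a white vertex.
\<close>

definition black_action :: "nat \<Rightarrow> nat" where
  "black_action = edge_action m (alpha, beta, 0)"

definition white_action :: "nat \<Rightarrow> nat" where
  "white_action = edge_action m (id, id, 1)"

lemma black_action:
  "i \<in> {1..m} \<Longrightarrow> black_action i = alpha i"
  "i \<in> {1..m} \<Longrightarrow> black_action (m + i) = m + beta i"
  using edge_action_simps[OF alpha_permutes beta_permutes] by (simp_all add: black_action_def)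

lemma white_action:
  "i \<in> {1..m} \<Longrightarrow> white_action i = m + i"
  "i \<in> {1..m} \<Longrightarrow> white_action (m + i) = i"
  using edge_action_simps[OF permutes_id permutes_id] by (simp_all add: white_action_def)

lemma edge_cases:
  assumes "i \<in> {1..2 * m}"
  obtains "i \<in> {1..m}" | j where "i = m + j" "j \<in> {1..m}"
proof (cases "i \<le> m")
  case False
  then have "i = m + (i - m)" "i - m \<in> {1..m}" using assms by auto
  then show ?thesis using that by blast
qed (use assms that in auto)

lemma actions_closed:
  assumes "i \<in> {1..2 * m}"
  shows "black_action i \<in> {1..2 * m}" "white_action i \<in> {1..2 * m}"
proof -
  have "(alpha, beta, 0) \<in> carrier (wreath_Z2 (sym_group m))"
    "(id, id, 1) \<in> carrier (wreath_Z2 (sym_group m))"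
    using wreath_gens_carrier by (simp_all add: wreath_gens_def)
  from this[THEN edge_action_permutes, THEN permutes_in_image, of i]
  show "black_action i \<in> {1..2 * m}" "white_action i \<in> {1..2 * m}"
    unfolding black_action_def white_action_def using assms by blast+
qed

end

text \<open>
  A tree with the given passport, with \<open>p\<close> and \<open>q\<close> its branching black vertices. Since white vertices
  have degree 2, the edge \<open>wnext D e\<close> is the other edge at the white end of \<open>e\<close>.
\<close>

locale double_star = star_sizes r t m + dessin D
  for r t m :: nat and D :: "('v, 'e) dessin" +
  fixes p q :: 'v
  assumes acyclic: "\<nexists>vs es. cycle_in D vs es"
    and pq: "p \<in> black D" "q \<in> black D" "p \<noteq> q"
    and degree_pq: "degree D p = r" "degree D q = t"
    and degree_leaf: "\<And>v. v \<in> black D \<Longrightarrow> v \<noteq> p \<Longrightarrow> v \<noteq> q \<Longrightarrow> degree D v = 1"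
    and degree_white: "\<And>v. v \<in> white D \<Longrightarrow> degree D v = 2"
    and card_white: "card (white D) = m"
begin

lemma leaf_fixed:
  assumes e: "e \<in> edges D" and "bend D e \<noteq> p" "bend D e \<noteq> q"
  shows "bnext D e = e"
  using bnext_period(1)[OF e] degree_leaf[OF bend_black[OF e]] assms by simp

lemma mate_mate: "e \<in> edges D \<Longrightarrow> wnext D (wnext D e) = e"
  using wnext_period(1)[of e] degree_white[OF wend_white, of e] by (simp add: numeral_2_eq_2)

lemma mate_neq: "e \<in> edges D \<Longrightarrow> wnext D e \<noteq> e"
  using wnext_period(2)[of e 1] degree_white[OF wend_white, of e] by simp

lemma same_wend:
  assumes e: "e \<in> edges D" and d: "d \<in> edges D" and eq: "wend D e = wend D d"
  shows "d = e \<or> d = wnext D e"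
proof -
  obtain k where k: "d = (wnext D ^^ k) e" using eq same_wend_iff[OF e d] by blast
  have "(wnext D ^^ k) e = e \<or> (wnext D ^^ k) e = wnext D e"
    by (induction k) (auto simp: mate_mate[OF e])
  then show ?thesis using k by simp
qed

lemma ends_ordered: "e \<in> edges D \<Longrightarrow> bend D e \<noteq> wend D d" if "d \<in> edges D" for d
  using bend_black[of e] wend_white[OF that] disjoint by auto

lemma no_parallel:
  assumes e: "e \<in> edges D"
  shows "bend D (wnext D e) \<noteq> bend D e"
proof
  let ?d = "wnext D e"
  assume eq: "bend D ?d = bend D e"
  have d: "?d \<in> edges D" "wend D ?d = wend D e" using wnext_star[OF e] by auto
  have "cycle_in D [bend D e, wend D e, bend D e] [e, ?d]"
    using e d eq mate_neq[OF e] bend_vertex[OF e] wend_vertex[OF e] ends_ordered[OF e e]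
    by (auto simp: cycle_in_def walk_def ends_def less_Suc_eq)
  then show False using acyclic by blast
qed

lemma unique_bridge:
  assumes e: "e \<in> edges D" "bend D e = p" "bend D (wnext D e) = q"
    and d: "d \<in> edges D" "bend D d = p" "bend D (wnext D d) = q"
  shows "e = d"
proof (rule ccontr)
  assume ne: "e \<noteq> d"
  let ?e' = "wnext D e" and ?d' = "wnext D d"
  have e': "?e' \<in> edges D" "wend D ?e' = wend D e" using wnext_star[OF e(1)] by auto
  have d': "?d' \<in> edges D" "wend D ?d' = wend D d" using wnext_star[OF d(1)] by auto
  have w: "wend D e \<noteq> wend D d"
    using same_wend[OF e(1) d(1)] ne e(3) d(2) pq(3) by auto
  have "?e' \<noteq> ?d'" using mate_mate[OF e(1)] mate_mate[OF d(1)] ne by auto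
  moreover have "e \<noteq> ?e'" "e \<noteq> ?d'" "d \<noteq> ?e'" "d \<noteq> ?d'" using e d pq(3) by auto
  ultimately have "distinct [e, ?e', ?d', d]" using ne by simp
  moreover have "walk D [p, wend D e, q, wend D d, p] [e, ?e', ?d', d]"
    using e d e' d' wend_vertex[OF e(1)] wend_vertex[OF d(1)] pq
    by (auto simp: walk_def ends_def vertices_def less_Suc_eq)
  moreover have "distinct [wend D e, q, wend D d, p]"
    using w pq(3) ends_ordered[OF e(1) e(1)] ends_ordered[OF d(1) e(1)]
      ends_ordered[OF e(1) e'(1)] ends_ordered[OF d(1) e'(1)] e d by auto
  ultimately have "cycle_in D [p, wend D e, q, wend D d, p] [e, ?e', ?d', d]"
    by (simp add: cycle_in_def)
  then show False using acyclic by blast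
qed

lemma star_nonempty: "\<exists>e \<in> edges D. bend D e = q"
proof -
  have "star D q \<noteq> {}" using degree_pq(2) sizes(2) by (auto simp: degree_def)
  then show ?thesis using star_black[OF pq(2)] by auto
qed

lemma star_nonempty': "\<exists>e \<in> edges D. bend D e = p"
proof -
  have "star D p \<noteq> {}" using degree_pq(1) sizes(1) by (auto simp: degree_def)
  then show ?thesis using star_black[OF pq(1)] by auto
qed

text \<open>
  Otherwise the edges at \<open>p\<close> together with the second edges at their white ends would be closed under
  both rotations.
\<close>

lemma bridge_exists: "\<exists>e \<in> edges D. bend D e = p \<and> bend D (wnext D e) = q"
proof (rule ccontr)
  assume none: "\<not> ?thesis"
  define S where "S = {e \<in> edges D. bend D e = p \<or> bend D (wnext D e) = p}"
  have "S = edges D"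
  proof (rule transitive)
    show "S \<subseteq> edges D" by (auto simp: S_def)
    show "S \<noteq> {}" using star_nonempty' by (auto simp: S_def)
    show "wnext D e \<in> S" if "e \<in> S" for e
      using that wnext_star[of e] mate_mate[of e] by (auto simp: S_def)
    show "bnext D e \<in> S" if e: "e \<in> S" for e
    proof (cases "bend D e = p")
      case True
      then show ?thesis using e bnext_star[of e] by (auto simp: S_def)
    next
      case False
      then have eE: "e \<in> edges D" "bend D (wnext D e) = p" using e by (auto simp: S_def)
      have "bend D e \<noteq> q"
        using none wnext_star[OF eE(1)] eE(2) mate_mate[OF eE(1)] by auto
      then show ?thesis using leaf_fixed[OF eE(1) False] e by simp
    qed
  qed
  moreover obtain e where e: "e \<in> edges D" "bend D e = q" using star_nonempty by blast
  ultimately have "bend D (wnext D e) = p" using pq(3) by (auto simp: S_def)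
  then show False using none wnext_star[OF e(1)] mate_mate[OF e(1)] e(2) by auto
qed

lemma card_edges: "card (edges D) = 2 * m"
proof -
  have "edges D = (\<Union>v \<in> white D. star D v)"
    using wend_white by (auto simp: star_white)
  also have "card \<dots> = (\<Sum>v \<in> white D. card (star D v))"
    using finite_white finite_edges by (intro card_UN_disjoint) (auto simp: star_white)
  also have "\<dots> = (\<Sum>v \<in> white D. 2)"
    using degree_white by (intro sum.cong) (auto simp: degree_def)
  finally show ?thesis using card_white by simp
qed

text \<open>
  The numbering starts with the edge that joins \<open>p\<close> to the white vertex between
  \<open>p\<close> and \<open>q\<close>, follows the rotation around \<open>p\<close>, then takes the leaf edges opposite to the edges at
  \<open>q\<close> in the order of rotation around \<open>q\<close>, and numbers opposite edges with a shift by \<open>m\<close>.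
\<close>

lemma edge_numbering:
  "\<exists>g. bij_betw g {1..2 * m} (edges D) \<and>
    (\<forall>i \<in> {1..2 * m}. g (black_action i) = bnext D (g i)) \<and>
    (\<forall>i \<in> {1..2 * m}. g (white_action i) = wnext D (g i))"
proof -
  obtain e0 where e0: "e0 \<in> edges D" "bend D e0 = p" "bend D (wnext D e0) = q"
    using bridge_exists by blast
  let ?f0 = "wnext D e0"
  have f0: "?f0 \<in> edges D" using wnext_star[OF e0(1)] by simp
  define e where "e k = (bnext D ^^ k) e0" for k
  define f where "f k = (bnext D ^^ k) ?f0" for k
  have eE: "e k \<in> edges D" "bend D (e k) = p" for k
    using bnext_funpow[OF e0(1), of k] e0(2) by (simp_all add: e_def)
  have fE: "f k \<in> edges D" "bend D (f k) = q" for k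
    using bnext_funpow[OF f0, of k] e0(3) by (simp_all add: f_def)
  have e_Suc: "bnext D (e k) = e (Suc k)" and f_Suc: "bnext D (f k) = f (Suc k)" for k
    by (simp_all add: e_def f_def)
  have e_0: "e 0 = e0" and f_0: "f 0 = ?f0" by (simp_all add: e_def f_def)
  have e_r: "e r = e0" using bnext_period(1)[OF e0(1)] e0(2) degree_pq by (simp add: e_def)
  have f_t: "f t = ?f0" using bnext_period(1)[OF f0] e0(3) degree_pq by (simp add: f_def)
  have e_leaf: "bnext D (wnext D (e k)) = wnext D (e k)" if k: "0 < k" "k < r" for k
  proof (rule leaf_fixed)
    have "e k \<noteq> e0" using bnext_period(2)[OF e0(1) k(1)] k(2) e0(2) degree_pq by (simp add: e_def)
    then show "bend D (wnext D (e k)) \<noteq> q" using unique_bridge[OF e0 eE(1) eE(2)] by metis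
    show "bend D (wnext D (e k)) \<noteq> p" using no_parallel[OF eE(1), of k] eE(2)[of k] by simp
    show "wnext D (e k) \<in> edges D" using wnext_star eE by simp
  qed
  have f_leaf: "bnext D (wnext D (f k)) = wnext D (f k)" if k: "0 < k" "k < t" for k
  proof (rule leaf_fixed)
    have ne: "f k \<noteq> ?f0" using bnext_period(2)[OF f0 k(1)] k(2) e0(3) degree_pq by (simp add: f_def)
    show "bend D (wnext D (f k)) \<noteq> p"
    proof
      assume "bend D (wnext D (f k)) = p"
      then have "e0 = wnext D (f k)"
        using unique_bridge[OF e0, of "wnext D (f k)"] wnext_star fE mate_mate by simp
      then show False using ne mate_mate[OF fE(1)] by metis
    qed
    show "bend D (wnext D (f k)) \<noteq> q" using no_parallel[OF fE(1), of k] fE(2)[of k] by simp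
    show "wnext D (f k) \<in> edges D" using wnext_star fE by simp
  qed
  \<comment> \<open>\<open>h\<close> numbers one half of the edges, the one that \<open>alpha\<close> permutes.\<close>
  define h where "h i = (if i \<le> r then e (i - 1) else wnext D (f (i - r)))" for i
  define g where "g i = (if i \<le> m then h i else wnext D (h (i - m)))" for i
  have hE: "h i \<in> edges D" for i using eE fE wnext_star by (simp add: h_def)
  have gE: "g i \<in> edges D" for i using hE wnext_star by (simp add: g_def)
  have g_left: "g i = h i" if "i \<in> {1..m}" for i using that by (simp add: g_def)
  have g_right: "g (m + i) = wnext D (h i)" if "i \<in> {1..m}" for i using that by (simp add: g_def)
  have white: "g (white_action i) = wnext D (g i)" if "i \<in> {1..2 * m}" for i
    using that
  proof (cases rule: edge_cases)
    case 1
    then show ?thesis by (simp only: white_action g_left g_right)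
  next
    case (2 j)
    then show ?thesis by (simp only: white_action g_left g_right mate_mate[OF hE])
  qed
  have h_alpha: "h (alpha i) = bnext D (h i)" if i: "i \<in> {1..m}" for i
  proof -
    consider "i \<in> {1..<r}" | "i = r" | "r < i" using i by force
    then show ?thesis
    proof cases
      case 1
      then show ?thesis using e_Suc[of "i - 1"] by (simp add: alpha_apply h_def)
    next
      case 2
      then show ?thesis using e_Suc[of "r - 1"] sizes e_r e_0 by (simp add: alpha_apply h_def)
    next
      case 3
      then show ?thesis using f_leaf[of "i - r"] i m by (simp add: alpha_apply h_def)
    qed
  qed
  have h_beta: "wnext D (h (beta i)) = bnext D (wnext D (h i))" if i: "i \<in> {1..m}" for i
  proof -
    have mate_f: "wnext D (h (r + k)) = f k" if "0 < k" for k
      using that mate_mate[OF fE(1)] by (simp add: h_def)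
    have h1: "wnext D (h 1) = f 0" using sizes e_0 f_0 by (simp add: h_def)
    consider "i = 1" | "i \<in> {2..r}" | (inner) k where "i = r + k" "0 < k" "k < t - 1"
      | (last) "i = r + (t - 1)"
    proof -
      have "i = 1 \<or> i \<in> {2..r} \<or> (i = r + (i - r) \<and> 0 < i - r \<and> i - r < t - 1) \<or> i = r + (t - 1)"
        using i m sizes by auto
      then show ?thesis using that by blast
    qed
    then show ?thesis
    proof cases
      case 1
      then show ?thesis using mate_f[of 1] f_Suc[of 0] h1 by (simp add: beta_apply)
    next
      case 2
      then have "beta i = i" unfolding beta_apply using sizes m by auto
      moreover have "0 < i - 1" "i - 1 < r" using 2 by auto
      ultimately show ?thesis using e_leaf[of "i - 1"] 2 by (simp add: h_def)
    next
      case (inner k)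
      have "beta i = r + Suc k" unfolding beta_apply using inner sizes m by auto
      then show ?thesis using inner mate_f[of k] mate_f[of "Suc k"] f_Suc[of k] by simp
    next
      case last
      have "beta i = 1" unfolding beta_apply using last sizes m by auto
      moreover have "f (Suc (t - 1)) = f 0" using f_t f_0 sizes by simp
      ultimately show ?thesis using last mate_f[of "t - 1"] f_Suc[of "t - 1"] h1 sizes by simp
    qed
  qed
  have black: "g (black_action i) = bnext D (g i)" if "i \<in> {1..2 * m}" for i
    using that
  proof (cases rule: edge_cases)
    case 1
    then have "alpha i \<in> {1..m}" by (simp only: permutes_in_image[OF alpha_permutes])
    then show ?thesis using 1 by (simp only: black_action g_left h_alpha)
  next
    case (2 j)
    then have "beta j \<in> {1..m}" by (simp only: permutes_in_image[OF beta_permutes])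
    then show ?thesis using 2 by (simp only: black_action g_right h_beta)
  qed
  have im: "g ` {1..2 * m} = edges D"
  proof (rule transitive)
    show "g ` {1..2 * m} \<subseteq> edges D" using gE by blast
    show "g ` {1..2 * m} \<noteq> {}" using sizes m by auto
    show "bnext D d \<in> g ` {1..2 * m}" if d: "d \<in> g ` {1..2 * m}" for d
    proof -
      obtain i where i: "i \<in> {1..2 * m}" "d = g i" using d by blast
      show ?thesis unfolding i(2) black[OF i(1), symmetric] by (rule imageI[OF actions_closed(1)[OF i(1)]])
    qed
    show "wnext D d \<in> g ` {1..2 * m}" if d: "d \<in> g ` {1..2 * m}" for d
    proof -
      obtain i where i: "i \<in> {1..2 * m}" "d = g i" using d by blast
      show ?thesis unfolding i(2) white[OF i(1), symmetric] by (rule imageI[OF actions_closed(2)[OF i(1)]])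
    qed
  qed
  then have "card (g ` {1..2 * m}) = card {1..2 * m}" by (simp only: im card_edges card_atLeastAtMost diff_Suc_1)
  from eq_card_imp_inj_on[OF finite_atLeastAtMost this] im
  have "bij_betw g {1..2 * m} (edges D)" by (simp add: bij_betw_def)
  then show ?thesis using black white by blast
qed

end

section \<open>Walks and cycles\<close>

text \<open>
  Ordered pairs of vertices joined by an edge.
\<close>

definition adjacent :: "('v, 'e) dessin \<Rightarrow> ('v \<times> 'v) set" where
  "adjacent D = {(u, v). \<exists>e \<in> edges D. ends D e = {u, v}}"

lemma walk_if_adjacent_rtrancl:
  assumes "(u, v) \<in> (adjacent D)\<^sup>*" "u \<in> vertices D"
    and verts: "\<And>e. e \<in> edges D \<Longrightarrow> ends D e \<subseteq> vertices D"
  shows "\<exists>vs es. walk D vs es \<and> hd vs = u \<and> last vs = v"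
  using assms(1)
proof (induction rule: rtrancl_induct)
  case base
  have "walk D [u] []" using assms(2) by (simp add: walk_def)
  then show ?case by force
next
  case (step y z)
  obtain vs es where w: "walk D vs es" "hd vs = u" "last vs = y" using step.IH by blast
  obtain e where e: "e \<in> edges D" "ends D e = {y, z}" using step.hyps by (auto simp: adjacent_def)
  have len: "length vs = Suc (length es)" using w(1) by (simp add: walk_def)
  then have "vs \<noteq> []" by auto
  with len w(3) have y: "vs ! length es = y" "vs \<noteq> []" by (simp_all add: last_conv_nth)
  have "ends D ((es @ [e]) ! i) = {(vs @ [z]) ! i, (vs @ [z]) ! Suc i}" if "i < Suc (length es)" for i
  proof (cases "i = length es")
    case True
    then show ?thesis using e(2) y(1) len by (simp add: nth_append)
  next
    case False
    then have "i < length es" using that by simp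
    then show ?thesis using w(1) len by (simp add: nth_append walk_def)
  qed
  then have "walk D (vs @ [z]) (es @ [e])"
    using w(1) len e verts[OF e(1)] by (auto simp: walk_def)
  moreover have "hd (vs @ [z]) = u" "last (vs @ [z]) = z" using w(2) y(2) by simp_all
  ultimately show ?case by blast
qed

lemma connected_if_root:
  assumes root: "x \<in> vertices D" "\<And>v. v \<in> vertices D \<Longrightarrow> (x, v) \<in> (adjacent D)\<^sup>*"
    and verts: "\<And>e. e \<in> edges D \<Longrightarrow> ends D e \<subseteq> vertices D"
  shows "connected_dessin D"
proof -
  have "sym (adjacent D)" by (auto simp: sym_def adjacent_def insert_commute)
  then have "sym ((adjacent D)\<^sup>*)" by (rule sym_rtrancl)
  then have "(u, v) \<in> (adjacent D)\<^sup>*" if "u \<in> vertices D" "v \<in> vertices D" for u v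
    using root(2) that by (meson rtrancl_trans symD)
  then show ?thesis
    unfolding connected_dessin_def using root(1) walk_if_adjacent_rtrancl[OF _ _ verts] by blast
qed

text \<open>
  The edges of a cycle form a subgraph of minimal degree at least 2.
\<close>

lemma cycle_edge_has_neighbour:
  assumes cyc: "cycle_in D vs es" and loopless: "\<And>e. e \<in> edges D \<Longrightarrow> bend D e \<noteq> wend D e"
    and e: "e \<in> set es" and v: "v \<in> ends D e"
  shows "\<exists>d \<in> set es. d \<noteq> e \<and> v \<in> ends D d"
proof -
  have w: "length vs = Suc (length es)" "set es \<subseteq> edges D"
    and ends: "\<And>i. i < length es \<Longrightarrow> ends D (es ! i) = {vs ! i, vs ! Suc i}"
    and cy: "es \<noteq> []" "hd vs = last vs" "distinct es"
    using cyc by (auto simp: cycle_in_def walk_def)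
  have "vs \<noteq> []" using w(1) by auto
  then have closed: "vs ! 0 = vs ! length es"
    using cy(2) w(1) by (simp add: hd_conv_nth last_conv_nth)
  have "length es \<noteq> 1"
  proof
    assume "length es = 1"
    then have "ends D (es ! 0) = {vs ! 0}" "es ! 0 \<in> edges D" using ends[of 0] closed w(2) by auto
    then show False using loopless[of "es ! 0"] by (auto simp: ends_def doubleton_eq_iff)
  qed
  then have len: "length es \<ge> 2" using cy(1) by (cases es; cases "tl es") auto
  obtain i where i: "i < length es" "e = es ! i" using e by (auto simp: in_set_conv_nth)
  have "\<exists>j < length es. j \<noteq> i \<and> v \<in> ends D (es ! j)"
  proof (cases "v = vs ! i")
    case True
    show ?thesis
    proof (cases i)
      case 0
      have "Suc (length es - 1) = length es" using len by simp
      with True closed 0 have "v \<in> ends D (es ! (length es - 1))"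
        using ends[of "length es - 1"] by simp
      then show ?thesis using 0 len by (intro exI[of _ "length es - 1"]) auto
    next
      case (Suc j)
      then show ?thesis using True ends[of j] i by (intro exI[of _ j]) auto
    qed
  next
    case False
    then have v': "v = vs ! Suc i" using v ends[OF i(1)] i(2) by auto
    show ?thesis
    proof (cases "Suc i = length es")
      case True
      have pos: "0 < length es" using len by linarith
      have "v \<in> ends D (es ! 0)" unfolding v' True closed[symmetric] ends[OF pos] by simp
      moreover have "0 \<noteq> i" using True len by linarith
      ultimately show ?thesis using pos by blast
    next
      case False
      then have Suc: "Suc i < length es" using i(1) by linarith
      have "v \<in> ends D (es ! Suc i)" unfolding v' ends[OF Suc] by simp
      then show ?thesis using Suc by (intro exI[of _ "Suc i"]) simp
    qed
  qed
  then show ?thesis using cy(3) i by (metis nth_eq_iff_index_eq nth_mem)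
qed

section \<open>The model tree\<close>

context star_sizes
begin

text \<open>
  The edges are \<open>1, \<dots>, 2 * m\<close>. The black vertices are \<open>1\<close> (with the edges \<open>1, \<dots>, r\<close>), \<open>m + 1\<close> (with
  the edges \<open>m + 1\<close> and \<open>m + r + 1, \<dots>, 2 * m\<close>) and the leaves, each named by its only edge. The white
  vertex \<open>2 * m + j\<close> has the edges \<open>j\<close> and \<open>m + j\<close>.
\<close>

definition model :: "(nat, nat) dessin" where
  "model = \<lparr>black = insert 1 {Suc r..m + r}, white = {2 * m + 1..3 * m}, edges = {1..2 * m},
     bend = (\<lambda>e. if e \<in> {1..r} then 1 else if e \<in> {Suc r..m} \<union> {m + 2..m + r} then e else m + 1),
     wend = (\<lambda>e. if e \<le> m then 2 * m + e else m + e),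
     rot = (\<lambda>v. if v \<le> 2 * m then black_action else white_action)\<rparr>"

lemma model_sel:
  "black model = insert 1 {Suc r..m + r}" "white model = {2 * m + 1..3 * m}" "edges model = {1..2 * m}"
  "bend model e = (if e \<in> {1..r} then 1 else if e \<in> {Suc r..m} \<union> {m + 2..m + r} then e else m + 1)"
  "wend model e = (if e \<le> m then 2 * m + e else m + e)"
  "rot model v = (if v \<le> 2 * m then black_action else white_action)"
  by (simp_all add: model_def)

lemma r_le_m: "r < m" "2 \<le> r"
  using sizes m by auto

lemma bend_model:
  assumes "e \<in> {1..2 * m}"
  shows "bend model e \<in> black model" "bend model e \<le> 2 * m" "1 \<le> bend model e"
  using assms r_le_m by (auto simp: model_sel)

lemma wend_model:
  assumes "e \<in> {1..2 * m}"
  shows "wend model e \<in> white model" "2 * m < wend model e"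
  using assms by (auto simp: model_sel)

lemma next_model:
  assumes "e \<in> {1..2 * m}"
  shows "bnext model e = black_action e" "wnext model e = white_action e"
  using bend_model(2)[OF assms] wend_model(2)[OF assms]
  by (simp_all add: bnext_def wnext_def model_sel(6))

lemma star_model_black:
  assumes "v \<le> 2 * m"
  shows "star model v = {e \<in> {1..2 * m}. bend model e = v}"
  using assms wend_model(2) by (auto simp: star_def ends_def model_sel(3)) (metis atLeastAtMost_iff leD le_trans)

lemma star_model_white:
  assumes "2 * m < v"
  shows "star model v = {e \<in> {1..2 * m}. wend model e = v}"
  using assms bend_model(2) by (auto simp: star_def ends_def model_sel(3)) (metis atLeastAtMost_iff leD le_trans)

lemma star_model_left: "star model 1 = {1..r}"
  using r_le_m by (subst star_model_black) (auto simp: model_sel(4) split: if_splits)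

lemma star_model_right: "star model (m + 1) = insert (m + 1) {m + Suc r..2 * m}"
  using r_le_m by (subst star_model_black) (auto simp: model_sel(4) split: if_splits)

lemma star_model_leaf:
  assumes "v \<in> {Suc r..m} \<union> {m + 2..m + r}"
  shows "star model v = {v}"
  using r_le_m assms by (subst star_model_black) (auto simp: model_sel(4) split: if_splits)

lemma star_model_mid:
  assumes "j \<in> {1..m}"
  shows "star model (2 * m + j) = {j, m + j}"
  using assms by (subst star_model_white) (auto simp: model_sel(5) split: if_splits)

lemma model_vertex_cases:
  assumes "v \<in> vertices model"
  obtains "v = 1" | "v = m + 1" | "v \<in> {Suc r..m} \<union> {m + 2..m + r}" | j where "v = 2 * m + j" "j \<in> {1..m}"
proof (cases "v \<in> white model")
  case True
  then have "v = 2 * m + (v - 2 * m)" "v - 2 * m \<in> {1..m}" by (auto simp: model_sel(2))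
  then show ?thesis using that(4) by blast
next
  case False
  then have "v = 1 \<or> v = m + 1 \<or> v \<in> {Suc r..m} \<union> {m + 2..m + r}"
    using assms by (auto simp: vertices_def model_sel(1,2))
  then show ?thesis using that(1-3) by blast
qed

lemma cyclic_star_model:
  assumes "v \<in> vertices model"
  shows "cyclic_on (rot model v) (star model v)"
  using assms
proof (cases rule: model_vertex_cases)
  case 1
  have rot: "rot model v = black_action" using 1 r_le_m by (simp add: model_sel(6))
  have "cyclic_on alpha {1..r}"
    using cyclic_on_cycle_of_list[of "[Suc 0..<Suc r]"] r_le_m
    by (simp add: alpha_def first_cycle atLeastLessThanSuc_atLeastAtMost del: upt_Suc)
  moreover have "black_action i = alpha i" if "i \<in> {1..r}" for i
    using that r_le_m by (intro black_action(1)) auto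
  ultimately show ?thesis
    unfolding rot unfolding 1 star_model_left using cyclic_cong[of "{1..r}" black_action alpha] by blast
next
  case 2
  have rot: "rot model v = black_action" using 2 r_le_m by (simp add: model_sel(6))
  let ?S = "set (Suc 0 # segment (Suc r) m)"
  have S: "?S = insert 1 {Suc r..m}" by (auto simp: segment_def)
  have "cyclic_on beta ?S"
    unfolding beta_def using distinct by (intro cyclic_on_cycle_of_list) simp_all
  moreover have "black_action (m + i) = m + beta i" if "i \<in> ?S" for i
    using that r_le_m unfolding S by (intro black_action(2)) auto
  ultimately have "cyclic_on black_action ((\<lambda>i. m + i) ` ?S)" by (rule cyclic_on_image)
  moreover have "(\<lambda>i. m + i) ` ?S = star model v"
    unfolding S 2 star_model_right image_insert image_add_atLeastAtMost by (simp add: mult_2 add.commute)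
  ultimately show ?thesis unfolding rot by simp
next
  case 3
  have rot: "rot model v = black_action" using 3 r_le_m by (auto simp: model_sel(6))
  have "black_action v = v"
  proof (cases "v \<le> m")
    case True
    then have "v \<in> {1..m}" "v \<in> {Suc r..m}" using 3 by auto
    then show ?thesis using black_action(1)[of v] alpha_apply[of v] by auto
  next
    case False
    then have v: "v = m + (v - m)" "v - m \<in> {1..m}" "v - m \<in> {2..r}" using 3 r_le_m by auto
    have "beta (v - m) = v - m" unfolding beta_apply using v(3) r_le_m by auto
    then show ?thesis using black_action(2)[OF v(2)] v(1) by simp
  qed
  then have "orbit black_action v = {v}" by (simp add: orbit_eq_singleton_iff)
  then show ?thesis unfolding rot star_model_leaf[OF 3] cyclic_on_def by simp
next
  case (4 j)
  have rot: "rot model v = white_action" using 4 by (simp add: model_sel(6))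
  have w: "white_action j = m + j" "white_action (m + j) = j" using white_action 4(2) by blast+
  have "orbit white_action j = {j, m + j}"
  proof
    have "y \<in> {j, m + j}" if "y \<in> orbit white_action j" for y
      using that by induction (auto simp: w)
    then show "orbit white_action j \<subseteq> {j, m + j}" by blast
    have "m + j \<in> orbit white_action j" using orbit.base[of white_action j] w(1) by simp
    moreover from orbit.step[OF this] have "j \<in> orbit white_action j" using w(2) by simp
    ultimately show "{j, m + j} \<subseteq> orbit white_action j" by blast
  qed
  then show ?thesis unfolding rot unfolding 4(1) star_model_mid[OF 4(2)] cyclic_on_def by blast
qed

lemma ends_model_vertices: "e \<in> edges model \<Longrightarrow> ends model e \<subseteq> vertices model"
  using bend_model(1)[of e] wend_model(1)[of e]
  by (simp add: ends_def vertices_def model_sel(3))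

lemma connected_model: "connected_dessin model"
proof (rule connected_if_root)
  show "1 \<in> vertices model" by (simp add: vertices_def model_sel(1))
  show "ends model e \<subseteq> vertices model" if "e \<in> edges model" for e
    by (rule ends_model_vertices[OF that])
  have adj: "(bend model e, wend model e) \<in> adjacent model" "(wend model e, bend model e) \<in> adjacent model"
    if "e \<in> {1..2 * m}" for e
    using that by (auto simp: adjacent_def model_sel(3) ends_def intro!: bexI[of _ e])
  have left: "(1, 2 * m + j) \<in> (adjacent model)\<^sup>*" if "j \<in> {1..r}" for j
    using adj(1)[of j] that r_le_m by (intro r_into_rtrancl) (auto simp: model_sel(4,5))
  have "(2 * m + 1, m + 1) \<in> adjacent model"
    using adj(2)[of "m + 1"] r_le_m by (simp add: model_sel(4,5) mult_2 add.assoc)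
  with left[of 1] r_le_m have hub: "(1, m + 1) \<in> (adjacent model)\<^sup>*"
    using rtrancl_into_rtrancl[of 1 "2 * m + 1"] by auto
  have right: "(1, 2 * m + j) \<in> (adjacent model)\<^sup>*" if "j \<in> {Suc r..m}" for j
  proof -
    have "(m + 1, 2 * m + j) \<in> adjacent model"
      using adj(1)[of "m + j"] that r_le_m by (auto simp: model_sel(4,5) mult_2 add.assoc)
    with hub show ?thesis by (rule rtrancl_into_rtrancl)
  qed
  have mid: "(1, 2 * m + j) \<in> (adjacent model)\<^sup>*" if "j \<in> {1..m}" for j
    using left[of j] right[of j] that by (cases "j \<le> r") auto
  show "(1, v) \<in> (adjacent model)\<^sup>*" if "v \<in> vertices model" for v
    using that
  proof (cases rule: model_vertex_cases)
    case 3
    have v: "v \<in> {1..2 * m}" using 3 r_le_m by auto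
    have "bend model v = v" using 3 r_le_m by (auto simp: model_sel(4))
    moreover obtain j where "wend model v = 2 * m + j" "j \<in> {1..m}"
    proof (cases "v \<le> m")
      case True
      then show ?thesis using v that[of v] by (simp add: model_sel(5))
    next
      case False
      then have "v - m \<in> {1..m}" "wend model v = 2 * m + (v - m)" using v by (auto simp: model_sel(5))
      then show ?thesis by (rule that[rotated])
    qed
    ultimately show ?thesis using adj(2)[OF v] mid[of j] by (metis rtrancl_into_rtrancl)
  qed (use hub mid in auto)
qed

lemma is_dessin_model: "is_dessin model"
  unfolding is_dessin_def
proof (intro conjI ballI impI)
  show "finite (vertices model)" "finite (edges model)" by (simp_all add: vertices_def model_sel)
  show "black model \<inter> white model = {}" using r_le_m by (auto simp: model_sel(1,2))
  show "bend model e \<in> black model" "wend model e \<in> white model" if "e \<in> edges model" for e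
    using bend_model(1)[of e] wend_model(1)[of e] that by (simp_all add: model_sel(3))
  show "connected_dessin model" by (rule connected_model)
  show "cyclic_on (rot model v) (star model v)" if "v \<in> vertices model" for v
    by (rule cyclic_star_model[OF that])
qed

text \<open>
  A cycle avoids leaves, hence also the white neighbours of leaves. Only the edges \<open>1\<close> and \<open>m + 1\<close>
  remain, and they have different black ends.
\<close>

lemma acyclic_model: "\<not> cycle_in model vs es"
proof
  assume cyc: "cycle_in model vs es"
  have loopless: "bend model e \<noteq> wend model e" if "e \<in> edges model" for e
    using bend_model(2)[of e] wend_model(2)[of e] that by (simp add: model_sel(3))
  have es: "set es \<subseteq> {1..2 * m}" "es \<noteq> []"
    using cyc by (auto simp: cycle_in_def walk_def model_sel(3))
  have nb: "\<exists>d \<in> set es. d \<noteq> e \<and> d \<in> star model v" if e: "e \<in> set es" "v \<in> ends model e" for e v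
  proof -
    obtain d where "d \<in> set es" "d \<noteq> e" "v \<in> ends model d"
      using cycle_edge_has_neighbour[OF cyc loopless e] by blast
    moreover from this(1) es(1) have "d \<in> edges model" unfolding model_sel(3) by blast
    ultimately show ?thesis unfolding star_def by blast
  qed
  have not_leaf: "e \<notin> {Suc r..m} \<union> {m + 2..m + r}" if e: "e \<in> set es" for e
  proof
    assume leaf: "e \<in> {Suc r..m} \<union> {m + 2..m + r}"
    then have "bend model e = e" using r_le_m by (auto simp: model_sel(4))
    then have "e \<in> ends model e" by (simp add: ends_def)
    from nb[OF e this] show False unfolding star_model_leaf[OF leaf] by blast
  qed
  have core: "e \<in> {1, m + 1}" if e: "e \<in> set es" for e
  proof -
    have "e \<in> {1..2 * m}" using e es by blast
    then obtain j where j: "j \<in> {1..m}" "e = j \<or> e = m + j" by (cases rule: edge_cases) auto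
    then have "wend model e = 2 * m + j" by (auto simp: model_sel(5))
    then have "2 * m + j \<in> ends model e" by (simp add: ends_def)
    from nb[OF e this] have "j \<in> set es" "m + j \<in> set es"
      unfolding star_model_mid[OF j(1)] using e j(2) by auto
    from not_leaf[OF this(1)] not_leaf[OF this(2)] have "j = 1" using j(1) by auto
    then show ?thesis using j(2) by auto
  qed
  obtain e where e: "e \<in> set es" using es(2) by (meson last_in_set)
  have "bend model e = e" using core[OF e] r_le_m by (auto simp: model_sel(4))
  then have "e \<in> ends model e" by (simp add: ends_def)
  from nb[OF e this] obtain d where d: "d \<in> set es" "d \<noteq> e" "d \<in> star model e" by blast
  have "d \<in> {1, m + 1}" by (rule core[OF d(1)])
  then show False
    using d(2,3) core[OF e] r_le_m star_model_left star_model_right by auto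
qed

lemma is_tree_model: "is_tree model"
  using is_dessin_model acyclic_model by (simp add: is_tree_def)

lemma degree_model:
  "degree model 1 = r" "degree model (m + 1) = t"
  "v \<in> {Suc r..m} \<union> {m + 2..m + r} \<Longrightarrow> degree model v = 1"
  "j \<in> {1..m} \<Longrightarrow> degree model (2 * m + j) = 2"
proof -
  show "degree model 1 = r" by (simp add: degree_def star_model_left[simplified])
  show "degree model (m + 1) = t"
    unfolding degree_def star_model_right using sizes m by (subst card_insert_disjoint) auto
  show "degree model v = 1" if "v \<in> {Suc r..m} \<union> {m + 2..m + r}"
    unfolding degree_def star_model_leaf[OF that] by simp
  show "degree model (2 * m + j) = 2" if "j \<in> {1..m}"
    unfolding degree_def star_model_mid[OF that] using r_le_m by simp
qed

lemma passport_model: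
  "passport model = ({#r, t#} + replicate_mset (r + t - 2) 1, replicate_mset (r + t - 1) 2)"
proof -
  let ?L = "{Suc r..m} \<union> {m + 2..m + r}"
  have black: "black model = insert 1 (insert (m + 1) ?L)" using r_le_m by (auto simp: model_sel(1))
  have "card ?L = r + t - 2" using r_le_m m sizes by (subst card_Un_disjoint) auto
  moreover have "image_mset (degree model) (mset_set ?L) = image_mset (\<lambda>_. 1) (mset_set ?L)"
    by (rule image_mset_cong) (simp add: degree_model(3))
  ultimately have L: "image_mset (degree model) (mset_set ?L) = replicate_mset (r + t - 2) 1"
    by (simp only: image_mset_const_eq size_mset_set)
  have notin: "1 \<notin> insert (m + 1) ?L" "m + 1 \<notin> ?L" using r_le_m by auto
  have "image_mset (degree model) (mset_set (black model)) = {#r, t#} + replicate_mset (r + t - 2) 1"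
  proof -
    have "mset_set (black model) = add_mset 1 (add_mset (m + 1) (mset_set ?L))"
      unfolding black using mset_set.insert[OF _ notin(1)] mset_set.insert[OF _ notin(2)]
      by (simp only: finite_insert finite_Un finite_atLeastAtMost simp_thms)
    then show ?thesis by (simp only: image_mset_add_mset L degree_model(1,2)) simp
  qed
  moreover have "image_mset (degree model) (mset_set (white model)) = replicate_mset (r + t - 1) 2"
  proof -
    have "degree model v = 2" if "v \<in> white model" for v
    proof -
      have "v - 2 * m \<in> {1..m}" "2 * m + (v - 2 * m) = v" using that by (auto simp: model_sel(2))
      then show ?thesis using degree_model(4)[of "v - 2 * m"] by simp
    qed
    then have "image_mset (degree model) (mset_set (white model)) = image_mset (\<lambda>_. 2) (mset_set (white model))"
      by (intro image_mset_cong) (simp add: model_sel(2))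
    also have "\<dots> = replicate_mset (r + t - 1) 2"
    proof -
      have "card (white model) = r + t - 1" unfolding m[symmetric] by (simp add: model_sel(2))
      then show ?thesis by (simp only: image_mset_const_eq size_mset_set)
    qed
    finally show ?thesis .
  qed
  ultimately show ?thesis by (simp add: passport_def)
qed

lemma double_star_if_passport:
  fixes D :: "('v, 'e) dessin"
  assumes tree: "is_tree D"
    and pass: "passport D = ({#r, t#} + replicate_mset (r + t - 2) 1, replicate_mset (r + t - 1) 2)"
  obtains p q where "double_star r t m D p q"
proof -
  interpret dessin D using tree by (intro dessin.intro) (simp add: is_tree_def)
  have b: "image_mset (degree D) (mset_set (black D)) = add_mset r (add_mset t (replicate_mset (r + t - 2) 1))"
    and w: "image_mset (degree D) (mset_set (white D)) = replicate_mset m 2"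
    using pass m by (simp_all add: passport_def)
  obtain M p where p: "mset_set (black D) = add_mset p M" "degree D p = r"
    "image_mset (degree D) M = add_mset t (replicate_mset (r + t - 2) 1)"
    using msed_map_invR[OF b] by blast
  obtain M' q where q: "M = add_mset q M'" "degree D q = t"
    "image_mset (degree D) M' = replicate_mset (r + t - 2) 1"
    using msed_map_invR[OF p(3)] by blast
  have mset: "mset_set (black D) = add_mset p (add_mset q M')" using p(1) q(1) by simp
  then have set: "black D = insert p (insert q (set_mset M'))"
    using finite_set_mset_mset_set[OF finite_black] by (metis set_mset_add_mset_insert)
  have "p \<noteq> q"
  proof
    assume "p = q"
    \<comment> \<open>a set of vertices has no multiplicities\<close>
    then have "count (mset_set (black D)) p \<ge> 2" by (simp add: mset)
    moreover have "count (mset_set (black D)) p \<le> 1" by (simp add: count_mset_set')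
    ultimately show False by linarith
  qed
  moreover have "degree D v = 1" if "v \<in> black D" "v \<noteq> p" "v \<noteq> q" for v
  proof -
    have "v \<in># M'" using that set by auto
    then have "degree D v \<in># image_mset (degree D) M'" by simp
    then show ?thesis unfolding q(3) by (simp split: if_splits)
  qed
  moreover have "degree D v = 2" if "v \<in> white D" for v
  proof -
    have "v \<in># mset_set (white D)" using that finite_white by simp
    then have "degree D v \<in># image_mset (degree D) (mset_set (white D))" by simp
    then show ?thesis unfolding w by (simp split: if_splits)
  qed
  moreover have "card (white D) = m" using arg_cong[OF w, of size] by simp
  moreover have "\<nexists>vs es. cycle_in D vs es" using tree by (simp add: is_tree_def)
  ultimately have "double_star r t m D p q"
    using p(2) q(2) set by unfold_locales auto
  then show ?thesis by (rule that)
qed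

end

context double_star
begin

lemma dessin_iso_model: "dessin_iso D model"
proof -
  obtain g where g: "bij_betw g {1..2 * m} (edges D)"
    "\<And>i. i \<in> {1..2 * m} \<Longrightarrow> g (black_action i) = bnext D (g i)"
    "\<And>i. i \<in> {1..2 * m} \<Longrightarrow> g (white_action i) = wnext D (g i)"
    using edge_numbering by blast
  let ?h = "inv_into {1..2 * m} g"
  have hg: "?h (g i) = i" if "i \<in> {1..2 * m}" for i
    using bij_betw_inv_into_left[OF g(1) that] .
  have ex: "\<exists>i \<in> {1..2 * m}. e = g i" if "e \<in> edges D" for e
    using g(1) that by (auto simp: bij_betw_def)
  show ?thesis
  proof (rule dessin_iso_if_intertwined)
    show "is_dessin D" by (rule dessin)
    show "is_dessin model" by (rule is_dessin_model)
    show "star D v \<noteq> {}" if "v \<in> vertices D" for v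
    proof -
      have "degree D v \<noteq> 0"
        using that degree_pq degree_leaf[of v] degree_white[of v] sizes
        by (cases "v = p"; cases "v = q") (auto simp: vertices_def)
      then show ?thesis by (auto simp: degree_def)
    qed
    show "star model v \<noteq> {}" if "v \<in> vertices model" for v
      using cyclic_star_model[OF that] by (auto simp: cyclic_on_def)
    show "bij_betw ?h (edges D) (edges model)"
      unfolding model_sel(3) by (rule bij_betw_inv_into[OF g(1)])
    show "?h (bnext D e) = bnext model (?h e)" if e: "e \<in> edges D" for e
    proof -
      obtain i where i: "i \<in> {1..2 * m}" "e = g i" using ex[OF e] by blast
      show ?thesis unfolding i(2) g(2)[OF i(1), symmetric] hg[OF i(1)] hg[OF actions_closed(1)[OF i(1)]]
        next_model(1)[OF i(1)] ..
    qed
    show "?h (wnext D e) = wnext model (?h e)" if e: "e \<in> edges D" for e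
    proof -
      obtain i where i: "i \<in> {1..2 * m}" "e = g i" using ex[OF e] by blast
      show ?thesis unfolding i(2) g(3)[OF i(1), symmetric] hg[OF i(1)] hg[OF actions_closed(2)[OF i(1)]]
        next_model(2)[OF i(1)] ..
    qed
  qed
qed

lemma monodromy_group_iso:
  assumes l: "labelling D l"
  shows "monodromy_group D l \<cong> subgroup_generated (wreath_Z2 (sym_group m)) wreath_gens"
proof -
  obtain g where g: "bij_betw g {1..2 * m} (edges D)"
    "\<And>i. i \<in> {1..2 * m} \<Longrightarrow> g (black_action i) = bnext D (g i)"
    "\<And>i. i \<in> {1..2 * m} \<Longrightarrow> g (white_action i) = wnext D (g i)"
    using edge_numbering by blast
  have lb: "bij_betw l (edges D) {1..2 * m}" using l by (simp add: labelling_def card_edges)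
  define \<pi> where "\<pi> i = (if i \<in> {1..2 * m} then l (g i) else i)" for i
  have "bij_betw \<pi> {1..2 * m} {1..2 * m}"
    using bij_betw_trans[OF g(1) lb] by (rule bij_betw_cong[THEN iffD1, rotated]) (simp add: \<pi>_def)
  then have pi: "\<pi> permutes {1..2 * m}"
    by (rule bij_imp_permutes) (unfold \<pi>_def, rule if_not_P)
  have il: "inv_into (edges D) l (l (g i)) = g i" if "i \<in> {1..2 * m}" for i
    using g(1) that by (intro bij_betw_inv_into_left[OF lb]) (auto simp: bij_betw_def)
  have s0: "sigma0 D l (\<pi> i) = \<pi> (black_action i)" for i
  proof (cases "i \<in> {1..2 * m}")
    case True
    have "\<pi> i \<in> {1..2 * m}" using True permutes_in_image[OF pi] by blast
    then have "sigma0 D l (\<pi> i) = l (bnext D (inv_into (edges D) l (\<pi> i)))"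
      unfolding sigma0_def card_edges Let_def bnext_def by (rule if_P)
    also have "inv_into (edges D) l (\<pi> i) = g i" using True il by (simp add: \<pi>_def)
    finally show ?thesis using True actions_closed(1)[OF True] g(2)[OF True] by (simp add: \<pi>_def)
  next
    case False
    have "black_action i = i" unfolding black_action_def by (rule edge_action_outside[OF False])
    moreover have "\<pi> i = i" unfolding \<pi>_def using False by (rule if_not_P)
    moreover have "sigma0 D l i = i" unfolding sigma0_def card_edges using False by (rule if_not_P)
    ultimately show ?thesis by simp
  qed
  have s1: "sigma1 D l (\<pi> i) = \<pi> (white_action i)" for i
  proof (cases "i \<in> {1..2 * m}")
    case True
    have "\<pi> i \<in> {1..2 * m}" using True permutes_in_image[OF pi] by blast
    then have "sigma1 D l (\<pi> i) = l (wnext D (inv_into (edges D) l (\<pi> i)))"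
      unfolding sigma1_def card_edges Let_def wnext_def by (rule if_P)
    also have "inv_into (edges D) l (\<pi> i) = g i" using True il by (simp add: \<pi>_def)
    finally show ?thesis using True actions_closed(2)[OF True] g(3)[OF True] by (simp add: \<pi>_def)
  next
    case False
    have "white_action i = i" unfolding white_action_def by (rule edge_action_outside[OF False])
    moreover have "\<pi> i = i" unfolding \<pi>_def using False by (rule if_not_P)
    moreover have "sigma1 D l i = i" unfolding sigma1_def card_edges using False by (rule if_not_P)
    ultimately show ?thesis by simp
  qed
  have "sigma0 D l = \<pi> \<circ> black_action \<circ> inv' \<pi>" "sigma1 D l = \<pi> \<circ> white_action \<circ> inv' \<pi>"
    using s0[of "inv' \<pi> i" for i] s1[of "inv' \<pi> i" for i] permutes_inverses(1)[OF pi]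
    by (simp_all add: fun_eq_iff)
  then have "{sigma0 D l, sigma1 D l} = (\<lambda>w. \<pi> \<circ> edge_action m w \<circ> inv' \<pi>) ` wreath_gens"
    by (simp add: wreath_gens_def black_action_def white_action_def)
  then show ?thesis
    unfolding monodromy_group_def card_edges
    using edge_action_conj_iso[OF pi _ wreath_gens_carrier] r_le_m by simp
qed

end

section \<open>Monodromy groups\<close>

context star_sizes
begin

lemma segment_lengths: "length (segment 2 r) = r - 1" "length (segment (Suc r) m) = t - 1"
  using m sizes by (simp_all add: segment_def)

lemma generated_carrier:
  "subgroup_generated (wreath_Z2 (sym_group m)) wreath_gens =
    (wreath_Z2 (sym_group m))\<lparr>carrier := wreath_gen\<rparr>"
  using wreath_gens_carrier by (simp add: subgroup_generated_def Int_absorb1)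

lemma generated_group:
  "r = t \<Longrightarrow> odd r \<Longrightarrow>
    subgroup_generated (wreath_Z2 (sym_group m)) wreath_gens \<cong> alt_group m \<times>\<times> integer_mod_group 2"
  "r = t \<Longrightarrow> even r \<Longrightarrow>
    subgroup_generated (wreath_Z2 (sym_group m)) wreath_gens \<cong> sym_group m \<times>\<times> integer_mod_group 2"
  "r \<noteq> t \<Longrightarrow> odd r \<Longrightarrow> odd t \<Longrightarrow>
    subgroup_generated (wreath_Z2 (sym_group m)) wreath_gens = wreath_Z2 (alt_group m)"
  "r \<noteq> t \<Longrightarrow> even r \<Longrightarrow> even t \<Longrightarrow>
    subgroup_generated (wreath_Z2 (sym_group m)) wreath_gens = R2 m"
  "even r \<longleftrightarrow> odd t \<Longrightarrow>
    subgroup_generated (wreath_Z2 (sym_group m)) wreath_gens = wreath_Z2 (sym_group m)"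
proof -
  have ne: "length (segment 2 r) \<noteq> length (segment (Suc r) m)" if "r \<noteq> t"
    unfolding segment_lengths using that sizes by auto
  have eq: "length (segment 2 r) = length (segment (Suc r) m)" if "r = t"
    unfolding segment_lengths using that by simp
  have parity: "even (length (segment 2 r)) \<longleftrightarrow> odd r" "even (length (segment (Suc r) m)) \<longleftrightarrow> odd t"
    unfolding segment_lengths using sizes by simp_all
  show "subgroup_generated (wreath_Z2 (sym_group m)) wreath_gens \<cong> alt_group m \<times>\<times> integer_mod_group 2"
    if "r = t" "odd r"
    using wreath_gen_equal_odd[OF eq[OF that(1)]] parity(1) that(2) by blast
  show "subgroup_generated (wreath_Z2 (sym_group m)) wreath_gens \<cong> sym_group m \<times>\<times> integer_mod_group 2"
    if "r = t" "even r"
    using wreath_gen_equal_even[OF eq[OF that(1)]] parity(1) that(2) by blast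
  show "subgroup_generated (wreath_Z2 (sym_group m)) wreath_gens = wreath_Z2 (alt_group m)"
    if "r \<noteq> t" "odd r" "odd t"
  proof -
    have "wreath_gen = carrier (wreath_Z2 (alt_group m))"
      using wreath_gen_odd_odd[OF ne[OF that(1)]] parity that by blast
    then show ?thesis
      unfolding generated_carrier by (simp add: wreath_Z2_def alt_group_def sym_group_def)
  qed
  show "subgroup_generated (wreath_Z2 (sym_group m)) wreath_gens = R2 m"
    if "r \<noteq> t" "even r" "even t"
  proof -
    have "wreath_gen = R2_carrier m"
      using wreath_gen_even_even[OF ne[OF that(1)]] parity that by blast
    then show ?thesis unfolding generated_carrier R2_def by simp
  qed
  show "subgroup_generated (wreath_Z2 (sym_group m)) wreath_gens = wreath_Z2 (sym_group m)"
    if "even r \<longleftrightarrow> odd t"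
  proof -
    have "wreath_gen = carrier (wreath_Z2 (sym_group m))"
      using wreath_gen_mixed parity that by blast
    then show ?thesis unfolding generated_carrier by simp
  qed
qed

end

theorem proposition8:
  fixes r t :: nat
  assumes "r > 1" and "t > 1"
  shows "\<exists>T :: (nat, nat) dessin.
    is_tree T \<and>
    passport T = ({#r, t#} + replicate_mset (r + t - 2) 1, replicate_mset (r + t - 1) 2) \<and>
    (\<forall>D :: ('v, 'e) dessin.
       is_tree D \<and>
       passport D = ({#r, t#} + replicate_mset (r + t - 2) 1, replicate_mset (r + t - 1) 2)
       \<longrightarrow> dessin_iso D T \<and>
         (\<forall>l. labelling D l \<longrightarrow>
           (r = t \<and> odd r \<longrightarrow>
              monodromy_group D l \<cong> alt_group (2 * r - 1) \<times>\<times> integer_mod_group 2) \<and>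
           (r = t \<and> even r \<longrightarrow>
              monodromy_group D l \<cong> sym_group (2 * r - 1) \<times>\<times> integer_mod_group 2) \<and>
           (r \<noteq> t \<and> odd r \<and> odd t \<longrightarrow>
              monodromy_group D l \<cong> wreath_Z2 (alt_group (r + t - 1))) \<and>
           (r \<noteq> t \<and> even r \<and> even t \<longrightarrow>
              monodromy_group D l \<cong> R2 (r + t - 1)) \<and>
           (r \<noteq> t \<and> (even r \<longleftrightarrow> odd t) \<longrightarrow>
              monodromy_group D l \<cong> wreath_Z2 (sym_group (r + t - 1)))))"
proof -
  interpret star_sizes r t "r + t - 1" using assms by unfold_locales auto
  let ?m = "r + t - 1"
  let ?G = "subgroup_generated (wreath_Z2 (sym_group ?m)) wreath_gens"
  show ?thesis
  proof (intro exI[of _ model] conjI allI impI is_tree_model passport_model; (elim conjE)?)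
    fix D :: "('v, 'e) dessin"
    assume "is_tree D"
      and "passport D = ({#r, t#} + replicate_mset (r + t - 2) 1, replicate_mset (r + t - 1) 2)"
    then obtain p q where "double_star r t ?m D p q" by (rule double_star_if_passport)
    then interpret D: double_star r t ?m D p q .
    show "dessin_iso D model" by (rule D.dessin_iso_model)
    fix l assume l: "labelling D l"
    have mono: "monodromy_group D l \<cong> ?G" by (rule D.monodromy_group_iso[OF l])
    show "monodromy_group D l \<cong> alt_group (2 * r - 1) \<times>\<times> integer_mod_group 2" if "r = t" "odd r"
      using iso_trans[OF mono generated_group(1)[OF that]] that(1) by (simp add: mult_2)
    show "monodromy_group D l \<cong> sym_group (2 * r - 1) \<times>\<times> integer_mod_group 2" if "r = t" "even r"
      using iso_trans[OF mono generated_group(2)[OF that]] that(1) by (simp add: mult_2)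
    show "monodromy_group D l \<cong> wreath_Z2 (alt_group ?m)" if "r \<noteq> t" "odd r" "odd t"
      using mono unfolding generated_group(3)[OF that] .
    show "monodromy_group D l \<cong> R2 ?m" if "r \<noteq> t" "even r" "even t"
      using mono unfolding generated_group(4)[OF that] .
    show "monodromy_group D l \<cong> wreath_Z2 (sym_group ?m)" if "r \<noteq> t" "even r = odd t"
      using mono unfolding generated_group(5)[OF that(2)] .
  qed
qed

end
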